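(* Let $\delta\ge \frac{\log\log n}{\log n}$. Any streaming algorithm making $\frac{1}{2\delta}-1$ passes that solves $\textsc{Set Cover}(U,\mathcal{F})$ optimally (i.e., outputs a minimum-size set cover) with constant probability of error requires $\tilde\Omega(mn^{\delta})$ memory space, where $n=|U|$, $m=|\mathcal{F}|$, in the regime $m=O(n)$.
   Context: Streaming Set Cover: a ground set $U$ of $n$ elements is stored in memory; a family $\mathcal{F}$ of $m$ subsets of $U$ arrives as a stream, read in sequential passes; the memory space is the amount of read-write memory used. A set cover is a subfamily of $\mathcal{F}$ whose union is $U$. $\tilde\Omega$ hides polylogarithmic factors in $n,m$; logarithms are base 2. *)

theory Defs
  imports "HOL-Probability.Probability"
begin

definition set_cover :: "'a set \<Rightarrow> 'a set set \<Rightarrow> 'a set set \<Rightarrow> bool" where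
  "set_cover U \<F> \<C> \<longleftrightarrow> \<C> \<subseteq> \<F> \<and> \<Union>\<C> = U"

definition minimum_set_cover :: "'a set \<Rightarrow> 'a set set \<Rightarrow> 'a set set \<Rightarrow> bool" where
  "minimum_set_cover U \<F> \<C> \<longleftrightarrow>
     set_cover U \<F> \<C> \<and> (\<forall>\<D>. set_cover U \<F> \<D> \<longrightarrow> card \<C> \<le> card \<D>)"

text \<open>
  The stream lists, in an arbitrary order, the \<open>m\<close> different members of a family of subsets of
  the ground set \<open>{..<n}\<close>. Only families possessing a cover are legal inputs.
\<close>

definition set_cover_stream :: "nat \<Rightarrow> nat \<Rightarrow> nat set list \<Rightarrow> bool" where
  "set_cover_stream n m xs \<longleftrightarrow>
     length xs = m \<and> distinct xs \<and> set xs \<subseteq> Pow {..<n} \<and> \<Union>(set xs) = {..<n}"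

text \<open>
  The read-write memory is a word of bits. The argument list of \<open>process\<close> is: number of the
  current pass, position in the stream, memory contents, and the set at that position; it
  returns the new memory contents and stream positions to be written to a write-only output
  tape. After the last pass \<open>finish\<close> may write further positions, depending on the memory.
  The ground set, the clock (pass, position), the scratch work inside a single step and the
  output tape are all free of charge, which only favours the algorithm.
\<close>

record stream_algorithm =
  init_mem :: "bool list"
  process :: "nat \<Rightarrow> nat \<Rightarrow> bool list \<Rightarrow> nat set \<Rightarrow> bool list \<times> nat set"
  finish :: "bool list \<Rightarrow> nat set"

fun run_pass :: "stream_algorithm \<Rightarrow> nat \<Rightarrow> nat \<Rightarrow> nat set list \<Rightarrow> bool list \<times> nat set
    \<Rightarrow> bool list \<times> nat set" where
  "run_pass a j i [] (w, out) = (w, out)"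
| "run_pass a j i (S # xs) (w, out) =
     (let (w', new) = process a j i w S in run_pass a j (Suc i) xs (w', out \<union> new))"

primrec run_passes :: "stream_algorithm \<Rightarrow> nat \<Rightarrow> nat set list \<Rightarrow> bool list \<times> nat set" where
  "run_passes a 0 xs = (init_mem a, {})"
| "run_passes a (Suc j) xs = run_pass a j 0 xs (run_passes a j xs)"

definition output_positions :: "stream_algorithm \<Rightarrow> nat \<Rightarrow> nat set list \<Rightarrow> nat set" where
  "output_positions a k xs = (let (w, out) = run_passes a k xs in out \<union> finish a w)"

definition uses_memory :: "stream_algorithm \<Rightarrow> nat \<Rightarrow> bool" where
  "uses_memory a s \<longleftrightarrow> length (init_mem a) = s \<and>
     (\<forall>j i w S. length w = s \<longrightarrow> length (fst (process a j i w S)) = s)"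

definition correct_output :: "stream_algorithm \<Rightarrow> nat \<Rightarrow> nat \<Rightarrow> nat set list \<Rightarrow> bool" where
  "correct_output a k n xs \<longleftrightarrow> output_positions a k xs \<subseteq> {..<length xs} \<and>
     minimum_set_cover {..<n} (set xs) ((!) xs ` output_positions a k xs)"

text \<open>
  A randomized algorithm is a distribution over deterministic ones. Because \<open>process\<close> sees the
  clock, this covers fresh coins in every step as well as a random tape that can be reread
  without being charged to the memory.
\<close>

definition randomized_memory :: "stream_algorithm pmf \<Rightarrow> nat \<Rightarrow> bool" where
  "randomized_memory A s \<longleftrightarrow> (\<forall>a \<in> set_pmf A. uses_memory a s)"

definition solves_set_cover ::
    "stream_algorithm pmf \<Rightarrow> nat \<Rightarrow> nat \<Rightarrow> nat \<Rightarrow> real \<Rightarrow> bool" where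
  "solves_set_cover A k n m \<epsilon> \<longleftrightarrow>
     (\<forall>xs. set_cover_stream n m xs \<longrightarrow>
        measure_pmf.prob A {a. \<not> correct_output a k n xs} \<le> \<epsilon>)"

end

theory Submission
  imports Defs "HOL-Real_Asymp.Real_Asymp"
begin

text \<open>
  Cut the stream into two halves that encode sets \<open>x\<close> and \<open>y\<close>. The memory contents at the cut
  and at the end of each pass form the transcript of a two-party protocol, so an algorithm
  with \<open>p\<close> passes and \<open>s\<close> bits communicates about \<open>2 p s\<close> bits, and it suffices to
  encode set disjointness on \<open>N\<close> points, which needs \<open>\<Omega>(N)\<close> bits, with \<open>N\<close> of order
  at least \<open>m sqrt n\<close>: since the number of passes is nonnegative, \<open>\<delta> \<le> 1 / 2\<close>, and the
  number of passes is at most \<open>log n\<close>.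

  If \<open>m\<^sup>2 \<le> n\<close>, the complements of \<open>x\<close> and \<open>y\<close>, subsets of a ground set of about \<open>n / 2\<close>
  elements, cover it if and only if \<open>x\<close> and \<open>y\<close> are disjoint; all other sets are padding.
  Otherwise \<open>x\<close> and \<open>y\<close> are \<open>q \<times> q\<close> tables with \<open>q\<close> of order \<open>min m n\<close>, every row of either
  table is one set, and there is a cover by three sets, namely equal rows \<open>i\<close> of both tables
  and a set choosing a column \<open>j\<close>, if and only if the tables share an entry \<open>(i, j)\<close>.

  The disjointness bound compares a random disjoint pair with the same pair after planting
  one common element. Given which coordinates belong to \<open>x\<close>, a disjoint pair is a uniform
  \<open>Z\<close>, and the level-one inequality together with the bound of entropy by the logarithm of the
  number of transcripts shows that for most coordinates the transcript hardly depends on the bit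
  of \<open>Z\<close> there, in Hellinger distance. The cut-and-paste property of rectangles then transfers
  this from the bits \<open>(0, 1)\<close> and \<open>(1, 0)\<close> to \<open>(1, 1)\<close>, so a protocol that is right with
  probability above one half must have long transcripts.
\<close>

section \<open>Level-one inequality and entropy\<close>

text \<open>Hoeffding's lemma for a fair sign, whose moment generating function is
  \<open>cosh\<close>. Evenness reduces the claim to nonnegative arguments.\<close>

lemma cosh_le_exp_half_square: "cosh (x::real) \<le> exp (x\<^sup>2 / 2)"
proof -
  have nonneg: "cosh y \<le> exp (y\<^sup>2 / 2)" if "y \<ge> 0" for y :: real
  proof -
    have "- y + ln ((1 + exp (2 * y)) / 2) \<le> y\<^sup>2 / 2"
      using Hoeffdings_lemma_aux[of "2 * y" "1/2"] that
      by (simp add: field_simps power2_eq_square)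
    moreover have "ln (cosh y) = - y + ln ((1 + exp (2 * y)) / 2)"
    proof -
      have "cosh y = exp (- y) * ((1 + exp (2 * y)) / 2)"
        by (simp add: cosh_def field_simps flip: exp_add)
      moreover have "(1 + exp (2 * y)) / 2 > 0"
        by (simp add: add_pos_pos)
      ultimately show ?thesis
        by (metis exp_gt_zero ln_exp ln_mult_pos)
    qed
    ultimately show ?thesis
      by (metis cosh_real_pos exp_le_cancel_iff exp_ln)
  qed
  show ?thesis
    using nonneg[of "\<bar>x\<bar>"] by (cases "x \<ge> 0") auto
qed

text \<open>The mean of \<open>spin Z j\<close> over a uniform \<open>Z\<close> in \<open>F\<close>:
  up to sign, the level-one Fourier coefficients of the density of \<open>F\<close>. For empty
  \<open>F\<close> the division by zero yields 0.\<close>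

definition bias :: "'a set set \<Rightarrow> 'a \<Rightarrow> real" where
  "bias F j = (real (card {Z \<in> F. j \<in> Z}) - real (card {Z \<in> F. j \<notin> Z})) / real (card F)"

definition spin :: "'a set \<Rightarrow> 'a \<Rightarrow> real" where
  "spin Z j = (if j \<in> Z then 1 else - 1)"

lemma sum_spin:
  assumes "finite F"
  shows "(\<Sum>Z\<in>F. spin Z j) = real (card F) * bias F j"
proof (cases "F = {}")
  case False
  have "(\<Sum>Z\<in>F. spin Z j) = (\<Sum>Z\<in>F \<inter> {Z. j \<in> Z}. 1) + (\<Sum>Z\<in>F \<inter> - {Z. j \<in> Z}. - 1)"
    unfolding spin_def using assms by (subst sum.If_cases) auto
  also have "\<dots> = real (card {Z \<in> F. j \<in> Z}) - real (card {Z \<in> F. j \<notin> Z})"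
    by (simp add: Int_def)
  finally show ?thesis
    using False assms by (simp add: bias_def)
qed simp

text \<open>Under the uniform measure on \<open>Pow I\<close> the spins are independent fair signs,
  so the exponential moment factors into terms \<open>2 * cosh (a j)\<close>.\<close>

lemma sum_exp_spin:
  assumes "finite I"
  shows "(\<Sum>Z\<in>Pow I. exp (\<Sum>j\<in>I. a j * spin Z j)) \<le> 2 ^ card I * exp ((\<Sum>j\<in>I. (a j)\<^sup>2) / 2)"
proof -
  have "(\<Sum>Z\<in>Pow I. exp (\<Sum>j\<in>I. a j * spin Z j))
      = (\<Sum>Z\<in>Pow I. (\<Prod>j\<in>Z. exp (a j)) * (\<Prod>j\<in>I - Z. exp (- a j)))"
  proof (rule sum.cong)
    fix Z assume Z: "Z \<in> Pow I"
    have "(\<Sum>j\<in>I. a j * spin Z j) = (\<Sum>j\<in>Z. a j * spin Z j) + (\<Sum>j\<in>I - Z. a j * spin Z j)"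
      using Z assms by (metis Pow_iff add.commute sum.subset_diff)
    also have "\<dots> = (\<Sum>j\<in>Z. a j) + (\<Sum>j\<in>I - Z. - a j)"
      by (intro arg_cong2[where f = "(+)"] sum.cong) (auto simp: spin_def)
    finally show "exp (\<Sum>j\<in>I. a j * spin Z j) = (\<Prod>j\<in>Z. exp (a j)) * (\<Prod>j\<in>I - Z. exp (- a j))"
      using Z assms by (auto simp: exp_add exp_sum finite_subset)
  qed simp
  also have "\<dots> = (\<Prod>j\<in>I. exp (a j) + exp (- a j))"
    by (rule prod_add[OF assms, symmetric])
  also have "\<dots> \<le> (\<Prod>j\<in>I. 2 * exp ((a j)\<^sup>2 / 2))"
    using cosh_le_exp_half_square by (intro prod_mono) (auto simp: cosh_def add_nonneg_nonneg mult.commute)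
  also have "\<dots> = 2 ^ card I * exp ((\<Sum>j\<in>I. (a j)\<^sup>2) / 2)"
    using assms by (simp add: prod.distrib sum_divide_distrib exp_sum)
  finally show ?thesis .
qed

text \<open>
  Jensen's inequality for the exponential moment of \<open>\<Sum>j. bias F j * spin Z j\<close>, whose
  average over \<open>F\<close> is the left-hand side.
\<close>

lemma sum_bias_square_le:
  assumes "finite I" "F \<subseteq> Pow I" "F \<noteq> {}"
  shows "(\<Sum>j\<in>I. (bias F j)\<^sup>2) \<le> 2 * ln (2 ^ card I / real (card F))"
proof -
  have fin: "finite F"
    using assms finite_subset by auto
  define B where "B = (\<Sum>j\<in>I. (bias F j)\<^sup>2)"
  define u where "u Z = (\<Sum>j\<in>I. bias F j * spin Z j)" for Z
  have card: "real (card F) > 0"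
    using fin assms by (simp add: card_gt_0_iff)
  have "(\<Sum>Z\<in>F. u Z) = (\<Sum>j\<in>I. bias F j * (\<Sum>Z\<in>F. spin Z j))"
    unfolding u_def by (subst sum.swap) (simp add: sum_distrib_left)
  then have mean: "(\<Sum>Z\<in>F. u Z) = real (card F) * B"
    by (simp add: sum_spin[OF fin] B_def sum_distrib_left power2_eq_square mult_ac)
  \<comment> \<open>Jensen through the tangent line of \<open>exp\<close> at \<open>B\<close>: since
    \<open>u\<close> has mean \<open>B\<close> on \<open>F\<close>, the linear term averages
    out.\<close>
  have "real (card F) * exp B = (\<Sum>Z\<in>F. exp B * (1 + (u Z - B)))"
    by (simp add: sum.distrib sum_subtractf mean flip: sum_distrib_left)
  also have "\<dots> \<le> (\<Sum>Z\<in>F. exp (u Z))"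
  proof (rule sum_mono)
    fix Z
    have "exp B * (1 + (u Z - B)) \<le> exp B * exp (u Z - B)"
      by (intro mult_left_mono exp_ge_add_one_self) auto
    then show "exp B * (1 + (u Z - B)) \<le> exp (u Z)"
      by (simp flip: exp_add)
  qed
  \<comment> \<open>Enlarging \<open>F\<close> to the whole cube is where the density of
    \<open>F\<close> enters the bound.\<close>
  also have "\<dots> \<le> (\<Sum>Z\<in>Pow I. exp (u Z))"
    using assms by (intro sum_mono2) auto
  also have "\<dots> \<le> 2 ^ card I * exp (B / 2)"
    unfolding u_def B_def by (rule sum_exp_spin[OF assms(1)])
  finally have "exp (B / 2) * exp (B / 2) * real (card F) \<le> 2 ^ card I * exp (B / 2)"
    by (simp add: mult.commute flip: exp_add)
  then have "exp (B / 2) \<le> 2 ^ card I / real (card F)"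
    using card by (simp add: field_simps)
  then have "B / 2 \<le> ln (2 ^ card I / real (card F))"
    using card by (subst ln_ge_iff) auto
  then show ?thesis
    by (simp add: B_def)
qed

text \<open>Follows from \<open>a - b = (sqrt a - sqrt b) * (sqrt a + sqrt b)\<close>. It turns the
  difference of two counts, hence a bias, into a Hellinger distance; the multiplied form covers
  \<open>a + b = 0\<close>.\<close>

lemma sqrt_diff_square_le:
  fixes a b :: real
  assumes "a \<ge> 0" "b \<ge> 0"
  shows "(sqrt a - sqrt b)\<^sup>2 * (a + b) \<le> (a - b)\<^sup>2"
proof -
  have "a + b \<le> (sqrt a + sqrt b)\<^sup>2"
    using assms by (simp add: power2_sum)
  then have "(sqrt a - sqrt b)\<^sup>2 * (a + b) \<le> (sqrt a - sqrt b)\<^sup>2 * (sqrt a + sqrt b)\<^sup>2"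
    by (intro mult_left_mono) auto
  also have "\<dots> = (a - b)\<^sup>2"
    using assms by (simp add: algebra_simps flip: power_mult_distrib)
  finally show ?thesis .
qed

lemma card_split_member:
  assumes "finite F"
  shows "card F = card {Z \<in> F. j \<in> Z} + card {Z \<in> F. j \<notin> Z}"
  using assms by (subst card_Un_disjoint[symmetric]) (auto intro: arg_cong[where f = card])

lemma sum_hellinger_fibre_le:
  assumes "finite I" "F \<subseteq> Pow I" "F \<noteq> {}"
  shows "(\<Sum>j\<in>I. (sqrt (card {Z \<in> F. j \<in> Z}) - sqrt (card {Z \<in> F. j \<notin> Z}))\<^sup>2)
       \<le> 2 * (real (card F) * ln (2 ^ card I / real (card F)))"
proof -
  have fin: "finite F"
    using assms finite_subset by auto
  have card: "real (card F) > 0"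
    using fin assms by (simp add: card_gt_0_iff)
  have "(sqrt (card {Z \<in> F. j \<in> Z}) - sqrt (card {Z \<in> F. j \<notin> Z}))\<^sup>2
      \<le> real (card F) * (bias F j)\<^sup>2" for j
  proof -
    let ?a = "card {Z \<in> F. j \<in> Z}" and ?b = "card {Z \<in> F. j \<notin> Z}"
    have "(sqrt ?a - sqrt ?b)\<^sup>2 * (real ?a + real ?b) \<le> (real ?a - real ?b)\<^sup>2"
      by (rule sqrt_diff_square_le) auto
    moreover have "real ?a + real ?b = real (card F)"
      using card_split_member[OF fin, of j] by simp
    ultimately have "(sqrt ?a - sqrt ?b)\<^sup>2 \<le> (real ?a - real ?b)\<^sup>2 / real (card F)"
      using card by (simp add: pos_le_divide_eq)
    also have "\<dots> = real (card F) * (bias F j)\<^sup>2"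
      using card by (simp add: bias_def power_divide power2_eq_square)
    finally show ?thesis .
  qed
  then have "(\<Sum>j\<in>I. (sqrt (card {Z \<in> F. j \<in> Z}) - sqrt (card {Z \<in> F. j \<notin> Z}))\<^sup>2)
      \<le> real (card F) * (\<Sum>j\<in>I. (bias F j)\<^sup>2)"
    by (simp add: sum_distrib_left sum_mono)
  also have "\<dots> \<le> real (card F) * (2 * ln (2 ^ card I / real (card F)))"
    by (intro mult_left_mono sum_bias_square_le assms) auto
  finally show ?thesis
    by (simp add: mult_ac)
qed

text \<open>Entropy is at most the logarithm of the support size, for weights of total
  \<open>W\<close> instead of probabilities. The proof uses \<open>ln t \<le> t - 1\<close> at
  \<open>t = W / (w k * card K)\<close>; the correction terms \<open>W / card K - w k\<close> sum to
  zero.\<close>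

lemma entropy_le:
  fixes w :: "'a \<Rightarrow> real" and W :: real
  assumes "finite K" "K \<noteq> {}" "\<And>k. k \<in> K \<Longrightarrow> w k \<ge> 0" "(\<Sum>k\<in>K. w k) = W" "W > 0"
  shows "(\<Sum>k\<in>K. w k * ln (W / w k)) \<le> W * ln (card K)"
proof -
  have card: "real (card K) > 0"
    using assms by (simp add: card_gt_0_iff)
  have "w k * ln (W / w k) \<le> w k * ln (card K) + (W / card K - w k)" if k: "k \<in> K" for k
  proof (cases "w k = 0")
    case False
    then have w: "w k > 0"
      using assms(3)[OF k] by simp
    have "ln (W / w k) - ln (card K) = ln (W / (w k * card K))"
      using w card assms(5) by (simp add: ln_div ln_mult)
    also have "\<dots> \<le> W / (w k * card K) - 1"
      using w card assms(5) by (intro ln_le_minus_one) auto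
    finally have "w k * (ln (W / w k) - ln (card K)) \<le> w k * (W / (w k * card K) - 1)"
      using w by (intro mult_left_mono) auto
    moreover have "w k * (W / (w k * card K) - 1) = W / card K - w k"
      using w by (simp add: right_diff_distrib)
    ultimately show ?thesis
      by (simp add: right_diff_distrib)
  qed (use assms(5) in auto)
  then have "(\<Sum>k\<in>K. w k * ln (W / w k)) \<le> (\<Sum>k\<in>K. w k * ln (card K) + (W / card K - w k))"
    by (rule sum_mono)
  also have "\<dots> = W * ln (card K)"
    using card assms(4) by (simp add: sum.distrib sum_subtractf flip: sum_distrib_right)
  finally show ?thesis .
qed

text \<open>Apply the level-one bound in every fibre of \<open>f\<close>. The right-hand sides add
  up to twice \<open>2 ^ card I\<close> times the entropy of \<open>f Z\<close> for uniform
  \<open>Z\<close>, which the size of \<open>\<Theta>\<close> controls.\<close>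

lemma sum_hellinger_le:
  fixes f :: "'a set \<Rightarrow> 'b"
  assumes "finite I" "finite \<Theta>" "f ` Pow I \<subseteq> \<Theta>"
  shows "(\<Sum>j\<in>I. \<Sum>\<tau>\<in>\<Theta>. (sqrt (card {Z \<in> Pow I. f Z = \<tau> \<and> j \<in> Z})
            - sqrt (card {Z \<in> Pow I. f Z = \<tau> \<and> j \<notin> Z}))\<^sup>2)
       \<le> 2 * (2 ^ card I * ln (card \<Theta>))"
proof -
  define F where "F \<tau> = {Z \<in> Pow I. f Z = \<tau>}" for \<tau>
  have sub: "F \<tau> \<subseteq> Pow I" for \<tau>
    by (auto simp: F_def)
  have "(\<Sum>\<tau>\<in>\<Theta>. real (card (F \<tau>))) = (\<Sum>\<tau>\<in>\<Theta>. \<Sum>Z | Z \<in> Pow I \<and> f Z = \<tau>. 1)"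
    by (simp add: F_def)
  also have "\<dots> = (\<Sum>Z\<in>Pow I. 1)"
    using assms by (intro sum.group) auto
  finally have total: "(\<Sum>\<tau>\<in>\<Theta>. real (card (F \<tau>))) = 2 ^ card I"
    using assms(1) by (simp add: card_Pow)
  have "(\<Sum>j\<in>I. \<Sum>\<tau>\<in>\<Theta>. (sqrt (card {Z \<in> Pow I. f Z = \<tau> \<and> j \<in> Z})
            - sqrt (card {Z \<in> Pow I. f Z = \<tau> \<and> j \<notin> Z}))\<^sup>2)
     = (\<Sum>\<tau>\<in>\<Theta>. \<Sum>j\<in>I. (sqrt (card {Z \<in> F \<tau>. j \<in> Z}) - sqrt (card {Z \<in> F \<tau>. j \<notin> Z}))\<^sup>2)"
    unfolding F_def by (subst sum.swap) (simp add: conj_assoc)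
  also have "\<dots> \<le> (\<Sum>\<tau>\<in>\<Theta>. 2 * (real (card (F \<tau>)) * ln (2 ^ card I / real (card (F \<tau>)))))"
  proof (rule sum_mono)
    fix \<tau>
    show "(\<Sum>j\<in>I. (sqrt (card {Z \<in> F \<tau>. j \<in> Z}) - sqrt (card {Z \<in> F \<tau>. j \<notin> Z}))\<^sup>2)
      \<le> 2 * (real (card (F \<tau>)) * ln (2 ^ card I / real (card (F \<tau>))))"
      using sum_hellinger_fibre_le[OF assms(1) sub[of \<tau>]] by (cases "F \<tau> = {}") auto
  qed
  also have "\<dots> \<le> 2 * (2 ^ card I * ln (card \<Theta>))"
  proof -
    have "\<Theta> \<noteq> {}" using assms(3) by auto
    from entropy_le[OF assms(2) this _ total] show ?thesis
      by (simp flip: sum_distrib_left)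
  qed
  finally show ?thesis .
qed

section \<open>Set disjointness by cut and paste\<close>

text \<open>The parts of a uniform \<open>Z\<close> inside and outside \<open>D\<close> are
  independent; this is why the counts of a rectangle factor.\<close>

lemma card_Pow_split:
  assumes "finite J" "D \<subseteq> J"
  shows "card {Z \<in> Pow J. P (Z \<inter> D) \<and> Q (Z - D)}
       = card {X \<in> Pow D. P X} * card {Y \<in> Pow (J - D). Q Y}"
proof -
  have "bij_betw (\<lambda>Z. (Z \<inter> D, Z - D)) {Z \<in> Pow J. P (Z \<inter> D) \<and> Q (Z - D)}
          ({X \<in> Pow D. P X} \<times> {Y \<in> Pow (J - D). Q Y})"
  proof (rule bij_betw_byWitness[where f' = "\<lambda>(X, Y). X \<union> Y"])
    show "(\<lambda>(X, Y). X \<union> Y) ` ({X \<in> Pow D. P X} \<times> {Y \<in> Pow (J - D). Q Y})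
        \<subseteq> {Z \<in> Pow J. P (Z \<inter> D) \<and> Q (Z - D)}"
    proof clarsimp
      fix X Y
      assume *: "X \<subseteq> D" "P X" "Y \<subseteq> J - D" "Q Y"
      then have "(X \<union> Y) \<inter> D = X" "X \<union> Y - D = Y"
        by auto
      then show "X \<subseteq> J \<and> Y \<subseteq> J \<and> P ((X \<union> Y) \<inter> D) \<and> Q (X \<union> Y - D)"
        using * assms by auto
    qed
  qed auto
  then show ?thesis
    by (simp add: bij_betw_same_card card_cartesian_product)
qed

lemma card_Pow_member:
  assumes "j \<in> I"
  shows "card {Z \<in> Pow I. P Z \<and> j \<in> Z} = card {Z \<in> Pow (I - {j}). P (insert j Z)}"
proof (rule bij_betw_same_card[of "\<lambda>Z. Z - {j}"], rule bij_betw_byWitness[where f' = "insert j"])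
qed (use assms in \<open>auto simp: insert_absorb\<close>)

lemma card_Pow_not_member:
  "card {Z \<in> Pow I. P Z \<and> j \<notin> Z} = card {Z \<in> Pow (I - {j}). P Z}"
  by (rule arg_cong[where f = card]) auto

lemma sum_Pow_member:
  fixes g :: "'a set \<Rightarrow> real"
  assumes "finite I" "j \<in> I"
  shows "(\<Sum>Z\<in>Pow I. g Z) = (\<Sum>Z\<in>Pow (I - {j}). g Z + g (insert j Z))"
proof -
  have "Pow I = Pow (I - {j}) \<union> insert j ` Pow (I - {j})"
    using assms(2) by (metis Pow_insert insert_Diff)
  moreover have "inj_on (insert j) (Pow (I - {j}))"
    by (auto simp: inj_on_def)
  moreover have "(\<Sum>Z\<in>Pow (I - {j}) \<union> insert j ` Pow (I - {j}). g Z)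
      = (\<Sum>Z\<in>Pow (I - {j}). g Z) + (\<Sum>Z\<in>insert j ` Pow (I - {j}). g Z)"
    using assms(1) by (intro sum.union_disjoint) auto
  ultimately show ?thesis
    by (simp add: sum.reindex sum.distrib)
qed

text \<open>Here \<open>a\<close> is the acceptance weight of a transcript. A weighted AM-GM
  inequality replaces Cauchy-Schwarz: the bound stays linear in the squared Hellinger distance, so
  it can be summed over coordinates with one common \<open>r\<close>.\<close>

lemma abs_sum_diff_le_hellinger:
  fixes p q a :: "'t \<Rightarrow> real"
  assumes "\<And>\<tau>. p \<tau> \<ge> 0" "\<And>\<tau>. q \<tau> \<ge> 0" "\<And>\<tau>. 0 \<le> a \<tau>" "\<And>\<tau>. a \<tau> \<le> 1" "r > 0"
  shows "\<bar>(\<Sum>\<tau>\<in>\<Theta>. a \<tau> * p \<tau>) - (\<Sum>\<tau>\<in>\<Theta>. a \<tau> * q \<tau>)\<bar>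
       \<le> r / 2 * (\<Sum>\<tau>\<in>\<Theta>. (sqrt (p \<tau>) - sqrt (q \<tau>))\<^sup>2)
         + ((\<Sum>\<tau>\<in>\<Theta>. p \<tau>) + (\<Sum>\<tau>\<in>\<Theta>. q \<tau>)) / r"
proof -
  have "\<bar>a \<tau> * p \<tau> - a \<tau> * q \<tau>\<bar> \<le> r / 2 * (sqrt (p \<tau>) - sqrt (q \<tau>))\<^sup>2 + (p \<tau> + q \<tau>) / r" for \<tau>
  proof -
    define u v where "u = \<bar>sqrt (p \<tau>) - sqrt (q \<tau>)\<bar>" and "v = sqrt (p \<tau>) + sqrt (q \<tau>)"
    have v: "v \<ge> 0" "v\<^sup>2 \<le> 2 * (p \<tau> + q \<tau>)"
    proof -
      have "0 \<le> (sqrt (p \<tau>) - sqrt (q \<tau>))\<^sup>2" by simp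
      then show "v\<^sup>2 \<le> 2 * (p \<tau> + q \<tau>)"
        using assms by (simp add: v_def power2_sum power2_diff)
    qed (use assms in \<open>simp add: v_def\<close>)
    have "p \<tau> - q \<tau> = (sqrt (p \<tau>) - sqrt (q \<tau>)) * v"
      using assms by (simp add: v_def algebra_simps)
    then have uv: "\<bar>p \<tau> - q \<tau>\<bar> = u * v"
      using v by (simp add: u_def abs_mult)
    have "\<bar>a \<tau> * p \<tau> - a \<tau> * q \<tau>\<bar> = a \<tau> * \<bar>p \<tau> - q \<tau>\<bar>"
      using assms(3)[of \<tau>] by (simp add: abs_mult flip: right_diff_distrib)
    also have "\<dots> \<le> 1 * \<bar>p \<tau> - q \<tau>\<bar>"
      using assms by (intro mult_right_mono) auto
    also have "\<dots> = u * v"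
      using uv by simp
    also have "\<dots> \<le> r / 2 * u\<^sup>2 + v\<^sup>2 / (2 * r)"
    proof -
      have "0 \<le> (r * u - v)\<^sup>2 / (2 * r)"
        using assms by simp
      also have "\<dots> = r / 2 * u\<^sup>2 + v\<^sup>2 / (2 * r) - u * v"
        using assms(5) by (simp add: power2_diff power2_eq_square field_simps)
      finally show ?thesis by simp
    qed
    also have "\<dots> \<le> r / 2 * u\<^sup>2 + (p \<tau> + q \<tau>) / r"
      using v assms(5) by (simp add: divide_simps)
    finally show ?thesis
      by (simp add: u_def)
  qed
  then have "(\<Sum>\<tau>\<in>\<Theta>. \<bar>a \<tau> * p \<tau> - a \<tau> * q \<tau>\<bar>)
      \<le> (\<Sum>\<tau>\<in>\<Theta>. r / 2 * (sqrt (p \<tau>) - sqrt (q \<tau>))\<^sup>2 + (p \<tau> + q \<tau>) / r)"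
    by (intro sum_mono)
  also have "\<dots> = r / 2 * (\<Sum>\<tau>\<in>\<Theta>. (sqrt (p \<tau>) - sqrt (q \<tau>))\<^sup>2)
         + ((\<Sum>\<tau>\<in>\<Theta>. p \<tau>) + (\<Sum>\<tau>\<in>\<Theta>. q \<tau>)) / r"
    by (simp add: sum.distrib add_divide_distrib sum_divide_distrib sum_distrib_left)
  finally show ?thesis
    using sum_abs[of "\<lambda>\<tau>. a \<tau> * p \<tau> - a \<tau> * q \<tau>" \<Theta>] by (simp add: sum_subtractf)
qed

text \<open>
  For a rectangle the counts factor, so that \<open>c00 * c11 = c01 * c10\<close>; the Hellinger distances of
  the pairs \<open>(c00, c11)\<close> and \<open>(c01, c10)\<close> then agree.
\<close>

lemma hellinger_cut_and_paste:
  fixes c00 c01 c10 c11 :: "'t \<Rightarrow> real"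
  assumes nonneg: "\<And>\<tau>. c00 \<tau> \<ge> 0" "\<And>\<tau>. c01 \<tau> \<ge> 0" "\<And>\<tau>. c10 \<tau> \<ge> 0" "\<And>\<tau>. c11 \<tau> \<ge> 0"
    and rect: "\<And>\<tau>. \<tau> \<in> \<Theta> \<Longrightarrow> c00 \<tau> * c11 \<tau> = c01 \<tau> * c10 \<tau>"
    and W: "(\<Sum>\<tau>\<in>\<Theta>. c00 \<tau>) = W" "(\<Sum>\<tau>\<in>\<Theta>. c01 \<tau>) = W" "(\<Sum>\<tau>\<in>\<Theta>. c10 \<tau>) = W" "(\<Sum>\<tau>\<in>\<Theta>. c11 \<tau>) = W"
  shows "(\<Sum>\<tau>\<in>\<Theta>. (sqrt (c00 \<tau>) - sqrt (c11 \<tau>))\<^sup>2)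
       \<le> 2 * (\<Sum>\<tau>\<in>\<Theta>. (sqrt (c01 \<tau>) - sqrt (c00 \<tau>))\<^sup>2)
         + 2 * (\<Sum>\<tau>\<in>\<Theta>. (sqrt (c10 \<tau>) - sqrt (c00 \<tau>))\<^sup>2)"
proof -
  have expand: "(sqrt x - sqrt y)\<^sup>2 = x + y - 2 * sqrt (x * y)" if "x \<ge> 0" "y \<ge> 0" for x y
    using that by (simp add: power2_diff real_sqrt_mult)
  have "(\<Sum>\<tau>\<in>\<Theta>. (sqrt (c00 \<tau>) - sqrt (c11 \<tau>))\<^sup>2)
      = (\<Sum>\<tau>\<in>\<Theta>. c00 \<tau> + c11 \<tau> - 2 * sqrt (c01 \<tau> * c10 \<tau>))"
    using nonneg rect by (intro sum.cong) (auto simp: expand)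
  \<comment> \<open>All four totals equal \<open>W\<close>, so the linear parts can be
    exchanged.\<close>
  also have "\<dots> = (\<Sum>\<tau>\<in>\<Theta>. c01 \<tau> + c10 \<tau> - 2 * sqrt (c01 \<tau> * c10 \<tau>))"
    using W by (simp add: sum.distrib sum_subtractf)
  also have "\<dots> = (\<Sum>\<tau>\<in>\<Theta>. (sqrt (c01 \<tau>) - sqrt (c10 \<tau>))\<^sup>2)"
    using nonneg by (simp add: expand)
  also have "\<dots> \<le> (\<Sum>\<tau>\<in>\<Theta>. 2 * (sqrt (c01 \<tau>) - sqrt (c00 \<tau>))\<^sup>2 + 2 * (sqrt (c10 \<tau>) - sqrt (c00 \<tau>))\<^sup>2)"
  proof (rule sum_mono)
    fix \<tau>
    have "(x - y)\<^sup>2 \<le> 2 * (x - z)\<^sup>2 + 2 * (y - z)\<^sup>2" for x y z :: real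
      using sum_squares_ge_zero[of "x + y - 2 * z" 0] by (simp add: power2_eq_square algebra_simps)
    then show "(sqrt (c01 \<tau>) - sqrt (c10 \<tau>))\<^sup>2
      \<le> 2 * (sqrt (c01 \<tau>) - sqrt (c00 \<tau>))\<^sup>2 + 2 * (sqrt (c10 \<tau>) - sqrt (c00 \<tau>))\<^sup>2" .
  qed
  finally show ?thesis
    by (simp add: sum.distrib sum_distrib_left)
qed

lemma sum_fibres:
  fixes a :: "'t \<Rightarrow> real"
  assumes "finite S" "finite \<Theta>" "f ` S \<subseteq> \<Theta>"
  shows "(\<Sum>Z\<in>S. a (f Z)) = (\<Sum>\<tau>\<in>\<Theta>. a \<tau> * real (card {Z \<in> S. f Z = \<tau>}))"
proof -
  have "(\<Sum>\<tau>\<in>\<Theta>. a \<tau> * real (card {Z \<in> S. f Z = \<tau>})) = (\<Sum>\<tau>\<in>\<Theta>. \<Sum>Z | Z \<in> S \<and> f Z = \<tau>. a (f Z))"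
    by (simp add: mult.commute)
  also have "\<dots> = (\<Sum>Z\<in>S. a (f Z))"
    using assms by (intro sum.group)
  finally show ?thesis by simp
qed

section \<open>Disjoint pairs against pairs with a planted common element\<close>

context
  fixes I :: "'i set" and T :: "'i set \<Rightarrow> 'i set \<Rightarrow> 't" and \<Theta> :: "'t set" and a :: "'t \<Rightarrow> real" and r :: real
  assumes finite_I: "finite I" and finite_\<Theta>: "finite \<Theta>"
    and T_in: "\<And>x y. x \<subseteq> I \<Longrightarrow> y \<subseteq> I \<Longrightarrow> T x y \<in> \<Theta>"
    and T_rectangle: "\<And>x y x' y'. x \<subseteq> I \<Longrightarrow> y \<subseteq> I \<Longrightarrow> x' \<subseteq> I \<Longrightarrow> y' \<subseteq> I \<Longrightarrow>
      T x y = T x' y' \<Longrightarrow> T x y' = T x y"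
    and a: "\<And>\<tau>. 0 \<le> a \<tau>" "\<And>\<tau>. a \<tau> \<le> 1"
    and r: "r > 0"
begin

text \<open>The players hold \<open>Z \<inter> D\<close> and \<open>Z - D\<close>, a disjoint pair.
  This is an unnormalised squared Hellinger distance between the transcripts with \<open>j\<close>
  in \<open>Z\<close> and those with \<open>j\<close> not in \<open>Z\<close>.\<close>

definition hellinger :: "'i set \<Rightarrow> 'i \<Rightarrow> real" where
  "hellinger D j = (\<Sum>\<tau>\<in>\<Theta>. (sqrt (card {Z \<in> Pow I. T (Z \<inter> D) (Z - D) = \<tau> \<and> j \<in> Z})
            - sqrt (card {Z \<in> Pow I. T (Z \<inter> D) (Z - D) = \<tau> \<and> j \<notin> Z}))\<^sup>2)"

text \<open>\<open>Z\<close> fixes all coordinates but \<open>j\<close>; the sets \<open>u\<close>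
  and \<open>v\<close>, each empty or \<open>{j}\<close> in every use, prescribe the bits of the two
  players at \<open>j\<close>.\<close>

definition restricted_count :: "'i set \<Rightarrow> 'i \<Rightarrow> 'i set \<Rightarrow> 'i set \<Rightarrow> 't \<Rightarrow> real" where
  "restricted_count D j u v \<tau> = real (card {Z \<in> Pow (I - {j}). T ((Z \<inter> D) \<union> u) ((Z - D) \<union> v) = \<tau>})"

lemma sum_hellinger_index: "D \<subseteq> I \<Longrightarrow> (\<Sum>j\<in>I. hellinger D j) \<le> 2 * (2 ^ card I * ln (card \<Theta>))"
  unfolding hellinger_def by (rule sum_hellinger_le) (auto intro!: T_in finite_I finite_\<Theta>)

text \<open>The fibre of a transcript is a product \<open>A \<times> B\<close>, so each count is a
  factor depending on \<open>u\<close> times a factor depending on \<open>v\<close>. Both sides are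
  the product of the same four factors.\<close>

lemma restricted_count_rectangle:
  assumes j: "j \<in> I" and D: "D \<subseteq> I - {j}"
  shows "restricted_count D j {} {} \<tau> * restricted_count D j {j} {j} \<tau>
       = restricted_count D j {} {j} \<tau> * restricted_count D j {j} {} \<tau>"
proof -
  define A where "A = {x. x \<subseteq> I \<and> (\<exists>y\<subseteq>I. T x y = \<tau>)}"
  define B where "B = {y. y \<subseteq> I \<and> (\<exists>x\<subseteq>I. T x y = \<tau>)}"
  have AB: "T x y = \<tau> \<longleftrightarrow> x \<in> A \<and> y \<in> B" if "x \<subseteq> I" "y \<subseteq> I" for x y
  proof
    assume "x \<in> A \<and> y \<in> B"
    then obtain y1 x1 where "y1 \<subseteq> I" "T x y1 = \<tau>" "x1 \<subseteq> I" "T x1 y = \<tau>"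
      unfolding A_def B_def by auto
    then show "T x y = \<tau>"
      using T_rectangle[of x y1 x1 y] that by simp
  qed (use that in \<open>auto simp: A_def B_def\<close>)
  have "restricted_count D j u v \<tau>
      = real (card {X \<in> Pow D. X \<union> u \<in> A}) * real (card {Y \<in> Pow (I - {j} - D). Y \<union> v \<in> B})"
    if "u \<subseteq> I" "v \<subseteq> I" for u v
  proof -
    have "{Z \<in> Pow (I - {j}). T ((Z \<inter> D) \<union> u) ((Z - D) \<union> v) = \<tau>}
        = {Z \<in> Pow (I - {j}). (Z \<inter> D) \<union> u \<in> A \<and> (Z - D) \<union> v \<in> B}"
      using that by (intro Collect_cong conj_cong refl AB) auto
    then show ?thesis
      unfolding restricted_count_def
      using card_Pow_split[of "I - {j}" D "\<lambda>X. X \<union> u \<in> A" "\<lambda>Y. Y \<union> v \<in> B"] finite_I D by simp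
  qed
  then show ?thesis
    using j by simp
qed

lemma restricted_count_sum:
  assumes "j \<in> I" "u \<subseteq> I" "v \<subseteq> I"
  shows "(\<Sum>Z\<in>Pow (I - {j}). b (T ((Z \<inter> D) \<union> u) ((Z - D) \<union> v)))
       = (\<Sum>\<tau>\<in>\<Theta>. b \<tau> * restricted_count D j u v \<tau>)"
  unfolding restricted_count_def
  by (rule sum_fibres) (use assms finite_I finite_\<Theta> in \<open>auto intro!: T_in\<close>)

text \<open>Pair each \<open>D\<close> avoiding \<open>j\<close> with \<open>insert j D\<close>.
  Under \<open>D\<close> the bit of \<open>Z\<close> at \<open>j\<close> belongs to the second
  player, so \<open>hellinger\<close> compares the cells (0,0) and (0,1); under
  \<open>insert j D\<close> it compares (0,0) and (1,0). Planting forces the cell (1,1), which cut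
  and paste reaches from these two distances.\<close>

lemma planted_diff_le:
  assumes j: "j \<in> I"
  shows "\<bar>(\<Sum>D\<in>Pow I. \<Sum>Z\<in>Pow I. a (T (Z \<inter> D) (Z - D)))
          - (\<Sum>D\<in>Pow I. \<Sum>Z\<in>Pow I. a (T (insert j (Z \<inter> D)) (insert j (Z - D))))\<bar>
       \<le> 9 / 2 * r * (\<Sum>D\<in>Pow I. hellinger D j) + 3 * 4 ^ card I / r"
proof -
  define W :: real where "W = 2 ^ (card I - 1)"
  have two_W: "2 ^ card I = 2 * W"
    using j finite_I unfolding W_def by (metis card_gt_0_iff empty_iff power_Suc Suc_pred')
  have four: "4 ^ card I = (2 * W) * (2 * W)"
    using power_mult_distrib[of "2::real" 2 "card I"] two_W by simp
  have card_J: "real (card (Pow (I - {j}))) = W"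
    using j finite_I by (simp add: card_Pow W_def)
  define g where "g D = (\<Sum>Z\<in>Pow I. a (T (Z \<inter> D) (Z - D)))" for D
  define h where "h D = (\<Sum>Z\<in>Pow I. a (T (insert j (Z \<inter> D)) (insert j (Z - D))))" for D
  have "\<bar>(g D + g (insert j D)) - (h D + h (insert j D))\<bar>
      \<le> 9 / 2 * r * (hellinger D j + hellinger (insert j D) j) + 12 * W / r"
    if D: "D \<in> Pow (I - {j})" for D
  proof -
    let ?c = "restricted_count D j"
    have jD: "j \<notin> D"
      using D by auto
    have split: "(\<Sum>Z\<in>Pow I. b Z) = (\<Sum>Z\<in>Pow (I - {j}). a (T (Z \<inter> D \<union> u) (Z - D \<union> v)))
          + (\<Sum>Z\<in>Pow (I - {j}). a (T (Z \<inter> D \<union> u') (Z - D \<union> v')))"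
      if "\<And>Z. Z \<subseteq> I - {j} \<Longrightarrow> b Z = a (T (Z \<inter> D \<union> u) (Z - D \<union> v))"
        "\<And>Z. Z \<subseteq> I - {j} \<Longrightarrow> b (insert j Z) = a (T (Z \<inter> D \<union> u') (Z - D \<union> v'))" for b u v u' v'
      using that by (simp add: sum_Pow_member[OF finite_I j] sum.distrib)
    have mem: "insert j Z \<inter> D = Z \<inter> D" "insert j Z - D = insert j (Z - D)"
      "insert j Z \<inter> insert j D = insert j (Z \<inter> D)" "insert j Z - insert j D = Z - D"
      "Z \<inter> insert j D = Z \<inter> D" "Z - insert j D = Z - D" if "Z \<subseteq> I - {j}" for Z
      using jD that by auto
    have total: "(\<Sum>\<tau>\<in>\<Theta>. ?c u v \<tau>) = W" if "u \<subseteq> I" "v \<subseteq> I" for u v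
      using restricted_count_sum[OF j that, of "\<lambda>_. 1" D] card_J by simp
    have "g D = (\<Sum>Z\<in>Pow (I - {j}). a (T (Z \<inter> D \<union> {}) (Z - D \<union> {})))
        + (\<Sum>Z\<in>Pow (I - {j}). a (T (Z \<inter> D \<union> {}) (Z - D \<union> {j})))"
      "g (insert j D) = (\<Sum>Z\<in>Pow (I - {j}). a (T (Z \<inter> D \<union> {}) (Z - D \<union> {})))
        + (\<Sum>Z\<in>Pow (I - {j}). a (T (Z \<inter> D \<union> {j}) (Z - D \<union> {})))"
      "h D = (\<Sum>Z\<in>Pow (I - {j}). a (T (Z \<inter> D \<union> {j}) (Z - D \<union> {j})))
        + (\<Sum>Z\<in>Pow (I - {j}). a (T (Z \<inter> D \<union> {j}) (Z - D \<union> {j})))"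
      "h (insert j D) = (\<Sum>Z\<in>Pow (I - {j}). a (T (Z \<inter> D \<union> {j}) (Z - D \<union> {j})))
        + (\<Sum>Z\<in>Pow (I - {j}). a (T (Z \<inter> D \<union> {j}) (Z - D \<union> {j})))"
      unfolding g_def h_def by (rule split; simp only: mem Un_empty_right Un_insert_right insert_absorb2)+
    then have gh: "g D = (\<Sum>\<tau>\<in>\<Theta>. a \<tau> * ?c {} {} \<tau>) + (\<Sum>\<tau>\<in>\<Theta>. a \<tau> * ?c {} {j} \<tau>)"
      "g (insert j D) = (\<Sum>\<tau>\<in>\<Theta>. a \<tau> * ?c {} {} \<tau>) + (\<Sum>\<tau>\<in>\<Theta>. a \<tau> * ?c {j} {} \<tau>)"
      "h D = 2 * (\<Sum>\<tau>\<in>\<Theta>. a \<tau> * ?c {j} {j} \<tau>)"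
      "h (insert j D) = 2 * (\<Sum>\<tau>\<in>\<Theta>. a \<tau> * ?c {j} {j} \<tau>)"
      using j by (simp_all only: restricted_count_sum[OF j] empty_subsetI insert_subset simp_thms mult_2)
    have hell: "hellinger D j = (\<Sum>\<tau>\<in>\<Theta>. (sqrt (?c {} {j} \<tau>) - sqrt (?c {} {} \<tau>))\<^sup>2)"
      "hellinger (insert j D) j = (\<Sum>\<tau>\<in>\<Theta>. (sqrt (?c {j} {} \<tau>) - sqrt (?c {} {} \<tau>))\<^sup>2)"
      unfolding hellinger_def restricted_count_def card_Pow_member[OF j] card_Pow_not_member
      by (simp_all add: mem cong: conj_cong)
    have nonneg: "?c u v \<tau> \<ge> 0" for u v \<tau>
      by (simp add: restricted_count_def)
    have diff: "\<bar>(\<Sum>\<tau>\<in>\<Theta>. a \<tau> * ?c u v \<tau>) - (\<Sum>\<tau>\<in>\<Theta>. a \<tau> * ?c u' v' \<tau>)\<bar>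
        \<le> r / 2 * (\<Sum>\<tau>\<in>\<Theta>. (sqrt (?c u v \<tau>) - sqrt (?c u' v' \<tau>))\<^sup>2) + 2 * W / r"
      if "u \<subseteq> I" "v \<subseteq> I" "u' \<subseteq> I" "v' \<subseteq> I" for u v u' v'
      using abs_sum_diff_le_hellinger[of "?c u v" "?c u' v'" a r \<Theta>] nonneg a r that
      by (simp add: total)
    have cp: "(\<Sum>\<tau>\<in>\<Theta>. (sqrt (?c {} {} \<tau>) - sqrt (?c {j} {j} \<tau>))\<^sup>2)
        \<le> 2 * hellinger D j + 2 * hellinger (insert j D) j"
      unfolding hell
      by (rule hellinger_cut_and_paste[where W = W])
        (use j D in \<open>auto simp: total nonneg restricted_count_rectangle\<close>)
    have 1: "\<bar>(\<Sum>\<tau>\<in>\<Theta>. a \<tau> * ?c {} {} \<tau>) - (\<Sum>\<tau>\<in>\<Theta>. a \<tau> * ?c {j} {j} \<tau>)\<bar>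
        \<le> r / 2 * (2 * hellinger D j + 2 * hellinger (insert j D) j) + 2 * W / r"
    proof -
      have "r / 2 * (\<Sum>\<tau>\<in>\<Theta>. (sqrt (?c {} {} \<tau>) - sqrt (?c {j} {j} \<tau>))\<^sup>2)
          \<le> r / 2 * (2 * hellinger D j + 2 * hellinger (insert j D) j)"
        using cp r by (intro mult_left_mono) auto
      then show ?thesis
        using diff[of "{}" "{}" "{j}" "{j}"] j by (smt (verit) empty_subsetI insert_subset)
    qed
    have 2: "\<bar>(\<Sum>\<tau>\<in>\<Theta>. a \<tau> * ?c {} {j} \<tau>) - (\<Sum>\<tau>\<in>\<Theta>. a \<tau> * ?c {} {} \<tau>)\<bar>
        \<le> r / 2 * hellinger D j + 2 * W / r"
      unfolding hell using diff[of "{}" "{j}" "{}" "{}"] j by simp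
    have 3: "\<bar>(\<Sum>\<tau>\<in>\<Theta>. a \<tau> * ?c {j} {} \<tau>) - (\<Sum>\<tau>\<in>\<Theta>. a \<tau> * ?c {} {} \<tau>)\<bar>
        \<le> r / 2 * hellinger (insert j D) j + 2 * W / r"
      unfolding hell using diff[of "{j}" "{}" "{}" "{}"] j by simp
    \<comment> \<open>With s00, s01, s10, s11 for the accepted counts of the cells, the difference
      is 4 (s00 - s11) + (s01 - s00) + (s10 - s00). Four times the first bound plus the other two
      gives the constants 9/2 and 12.\<close>
    from 1 2 3 show ?thesis
      unfolding gh by (simp add: ring_distribs)
  qed
  then have "(\<Sum>D\<in>Pow (I - {j}). \<bar>(g D + g (insert j D)) - (h D + h (insert j D))\<bar>)
      \<le> (\<Sum>D\<in>Pow (I - {j}). 9 / 2 * r * (hellinger D j + hellinger (insert j D) j) + 12 * W / r)"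
    by (rule sum_mono)
  also have "\<dots> = 9 / 2 * r * (\<Sum>D\<in>Pow I. hellinger D j) + W * (12 * W / r)"
    unfolding sum_Pow_member[OF finite_I j] sum_distrib_left
    by (subst sum.distrib) (simp add: card_J del: card_Pow)
  also have "W * (12 * W / r) = 3 * 4 ^ card I / r"
    using two_W by (simp add: four)
  finally have "(\<Sum>D\<in>Pow (I - {j}). \<bar>(g D + g (insert j D)) - (h D + h (insert j D))\<bar>)
      \<le> 9 / 2 * r * (\<Sum>D\<in>Pow I. hellinger D j) + 3 * 4 ^ card I / r" .
  moreover have "(\<Sum>D\<in>Pow I. g D) - (\<Sum>D\<in>Pow I. h D)
      = (\<Sum>D\<in>Pow (I - {j}). (g D + g (insert j D)) - (h D + h (insert j D)))"
    unfolding sum_Pow_member[OF finite_I j] by (simp add: sum_subtractf)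
  ultimately have "\<bar>(\<Sum>D\<in>Pow I. g D) - (\<Sum>D\<in>Pow I. h D)\<bar>
      \<le> 9 / 2 * r * (\<Sum>D\<in>Pow I. hellinger D j) + 3 * 4 ^ card I / r"
    using sum_abs[of "\<lambda>D. (g D + g (insert j D)) - (h D + h (insert j D))" "Pow (I - {j})"] by linarith
  then show ?thesis
    unfolding g_def h_def .
qed

text \<open>For fixed \<open>D\<close> the distances at all coordinates share one entropy budget, so
  a short transcript barely notices a planted element on average. The factor
  \<open>4 ^ card I\<close> counts the pairs \<open>(D, Z)\<close>.\<close>

lemma planted_average_diff_le:
  "\<bar>real (card I) * (\<Sum>D\<in>Pow I. \<Sum>Z\<in>Pow I. a (T (Z \<inter> D) (Z - D)))
     - (\<Sum>j\<in>I. \<Sum>D\<in>Pow I. \<Sum>Z\<in>Pow I. a (T (insert j (Z \<inter> D)) (insert j (Z - D))))\<bar>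
   \<le> 4 ^ card I * (9 * r * ln (card \<Theta>) + 3 * real (card I) / r)"
proof -
  have four: "(4 :: real) ^ card I = 2 ^ card I * 2 ^ card I"
    by (simp flip: power_mult_distrib)
  let ?g = "\<Sum>D\<in>Pow I. \<Sum>Z\<in>Pow I. a (T (Z \<inter> D) (Z - D))"
  let ?h = "\<lambda>j. \<Sum>D\<in>Pow I. \<Sum>Z\<in>Pow I. a (T (insert j (Z \<inter> D)) (insert j (Z - D)))"
  have "\<bar>real (card I) * ?g - (\<Sum>j\<in>I. ?h j)\<bar> = \<bar>\<Sum>j\<in>I. ?g - ?h j\<bar>"
    by (simp add: sum_subtractf)
  also have "\<dots> \<le> (\<Sum>j\<in>I. \<bar>?g - ?h j\<bar>)"
    by (rule sum_abs)
  also have "\<dots> \<le> (\<Sum>j\<in>I. 9 / 2 * r * (\<Sum>D\<in>Pow I. hellinger D j) + 3 * 4 ^ card I / r)"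
    by (intro sum_mono planted_diff_le)
  also have "\<dots> = 9 / 2 * r * (\<Sum>D\<in>Pow I. \<Sum>j\<in>I. hellinger D j) + real (card I) * (3 * 4 ^ card I / r)"
    by (subst sum.swap) (simp add: sum.distrib sum_distrib_left)
  also have "\<dots> \<le> 9 / 2 * r * (\<Sum>D\<in>Pow I. 2 * (2 ^ card I * ln (card \<Theta>))) + real (card I) * (3 * 4 ^ card I / r)"
    using r by (intro add_right_mono mult_left_mono sum_mono sum_hellinger_index) auto
  also have "\<dots> = 4 ^ card I * (9 * r * ln (card \<Theta>) + 3 * real (card I) / r)"
    by (simp add: card_Pow finite_I four field_simps)
  finally show ?thesis .
qed

end

section \<open>Streaming algorithms as two-party protocols\<close>

lemma run_pass_append:
  "run_pass a j i (xs @ ys) st = run_pass a j (i + length xs) ys (run_pass a j i xs st)"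
proof (induction xs arbitrary: i st)
  case Nil
  then show ?case by (cases st) simp
next
  case (Cons S xs)
  then show ?case by (cases st) (simp add: case_prod_beta Let_def)
qed

text \<open>The output tape is write-only: earlier output is carried along and never influences the
  memory.\<close>

lemma run_pass_out:
  "run_pass a j i xs (w, out)
   = (fst (run_pass a j i xs (w, {})), out \<union> snd (run_pass a j i xs (w, {})))"
proof (induction xs arbitrary: i w out)
  case Nil
  then show ?case by simp
next
  case (Cons S xs)
  obtain w' new where *: "process a j i w S = (w', new)"
    by fastforce
  show ?case
    using Cons.IH[of "Suc i" w' "out \<union> new"] Cons.IH[of "Suc i" w' new] by (simp add: * Un_assoc)
qed

lemma length_run_pass:
  assumes "uses_memory a s" "length w = s"
  shows "length (fst (run_pass a j i xs (w, out))) = s"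
  using assms(2)
proof (induction xs arbitrary: i w out)
  case (Cons S xs)
  then have "length (fst (process a j i w S)) = s"
    using assms(1) by (simp add: uses_memory_def)
  then show ?case
    using Cons.IH by (simp add: case_prod_beta Let_def)
qed simp

section \<open>Memory and output on either side of the cut\<close>

definition mem_after :: "stream_algorithm \<Rightarrow> nat \<Rightarrow> nat set list \<Rightarrow> bool list" where
  "mem_after a j xs = fst (run_passes a j xs)"

definition mid_mem :: "stream_algorithm \<Rightarrow> nat set list \<Rightarrow> nat set list \<Rightarrow> nat \<Rightarrow> bool list" where
  "mid_mem a xa xb j = fst (run_pass a j 0 xa (mem_after a j (xa @ xb), {}))"

definition first_out :: "stream_algorithm \<Rightarrow> nat set list \<Rightarrow> nat set list \<Rightarrow> nat \<Rightarrow> nat set" where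
  "first_out a xa xb p = (\<Union>j<p. snd (run_pass a j 0 xa (mem_after a j (xa @ xb), {})))"

text \<open>The first half enters only through its length, which sets the clock, and through the
  memory at the cut.\<close>

definition second_out :: "stream_algorithm \<Rightarrow> nat set list \<Rightarrow> nat set list \<Rightarrow> nat \<Rightarrow> nat set" where
  "second_out a xa xb p = (\<Union>j<p. snd (run_pass a j (length xa) xb (mid_mem a xa xb j, {})))"

lemma run_passes_Suc_split:
  "run_passes a (Suc j) (xa @ xb)
   = (fst (run_pass a j (length xa) xb (mid_mem a xa xb j, {})),
      snd (run_passes a j (xa @ xb)) \<union> snd (run_pass a j 0 xa (mem_after a j (xa @ xb), {}))
        \<union> snd (run_pass a j (length xa) xb (mid_mem a xa xb j, {})))"
proof -
  let ?w = "mem_after a j (xa @ xb)" and ?out = "snd (run_passes a j (xa @ xb))"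
  have "run_passes a (Suc j) (xa @ xb)
      = run_pass a j (length xa) xb (run_pass a j 0 xa (?w, ?out))"
    by (simp add: run_pass_append mem_after_def)
  then show ?thesis
    by (metis run_pass_out[of a j 0 xa ?w ?out] run_pass_out[of a j "length xa" xb "mid_mem a xa xb j"]
        mid_mem_def)
qed

lemma mem_after_Suc:
  "mem_after a (Suc j) (xa @ xb) = fst (run_pass a j (length xa) xb (mid_mem a xa xb j, {}))"
  unfolding mem_after_def run_passes_Suc_split[of a j xa xb] by simp

lemma run_passes_out: "snd (run_passes a p (xa @ xb)) = first_out a xa xb p \<union> second_out a xa xb p"
proof (induction p)
  case (Suc p)
  then show ?case
    unfolding run_passes_Suc_split by (auto simp: first_out_def second_out_def lessThan_Suc)
qed (simp add: first_out_def second_out_def)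

lemma output_positions_split:
  "output_positions a p (xa @ xb)
   = first_out a xa xb p \<union> second_out a xa xb p \<union> finish a (mem_after a p (xa @ xb))"
  by (simp add: output_positions_def case_prod_beta mem_after_def flip: run_passes_out)

lemma length_mem_after:
  assumes "uses_memory a s"
  shows "length (mem_after a j xs) = s"
proof (induction j)
  case 0
  then show ?case using assms by (simp add: mem_after_def uses_memory_def)
next
  case (Suc j)
  then show ?case
    using length_run_pass[OF assms Suc, of j 0 xs "snd (run_passes a j xs)"] by (simp add: mem_after_def)
qed

text \<open>The inclusion rules out infinite sets, whose \<open>card\<close> is 0, and so makes the
  notion pass to subsets.\<close>

definition small_subset :: "nat \<Rightarrow> nat \<Rightarrow> nat set \<Rightarrow> bool" where
  "small_subset m k P \<longleftrightarrow> P \<subseteq> {..<m} \<and> card P \<le> k"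

text \<open>
  Whether the whole output has at most \<open>k\<close> positions is not determined by the two halves'
  output sizes, so the transcript spells out what was written during the first half, unless
  that is already too large.
\<close>

definition transcript :: "stream_algorithm \<Rightarrow> nat \<Rightarrow> nat \<Rightarrow> nat \<Rightarrow> nat set list \<Rightarrow> nat set list
    \<Rightarrow> bool list list \<times> bool list list \<times> nat set option \<times> bool" where
  "transcript a p m k xa xb =
     (map (mid_mem a xa xb) [0..<p], map (\<lambda>j. mem_after a (Suc j) (xa @ xb)) [0..<p],
      if small_subset m k (first_out a xa xb p) then Some (first_out a xa xb p) else None,
      small_subset m k (output_positions a p (xa @ xb)))"

lemma small_subset_mono: "small_subset m k Q \<Longrightarrow> P \<subseteq> Q \<Longrightarrow> small_subset m k P"
  unfolding small_subset_def
  by (meson card_mono finite_lessThan finite_subset order_trans)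

text \<open>Run the mixed stream pass by pass: from equal memories the first half behaves as with
  \<open>xb\<close>, and the second half as in the run on \<open>xa' @ xb'\<close>, whose memories
  are the same. Equal lengths keep the clocks aligned.\<close>

lemma transcript_rectangle:
  assumes eq: "transcript a p m k xa xb = transcript a p m k xa' xb'" and len: "length xa = length xa'"
  shows "transcript a p m k xa xb' = transcript a p m k xa xb"
proof -
  have mid: "mid_mem a xa xb j = mid_mem a xa' xb' j"
    and aft: "mem_after a (Suc j) (xa @ xb) = mem_after a (Suc j) (xa' @ xb')" if "j < p" for j
    using eq that by (auto simp: transcript_def)
  have same: "mem_after a j (xa @ xb') = mem_after a j (xa @ xb)" if "j \<le> p" for j
    using that
  proof (induction j)
    case (Suc j)
    then have "mid_mem a xa xb' j = mid_mem a xa xb j"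
      by (simp add: mid_mem_def)
    then have "mem_after a (Suc j) (xa @ xb') = mem_after a (Suc j) (xa' @ xb')"
      using Suc.prems mid[of j] len by (simp add: mem_after_Suc)
    then show ?case
      using Suc.prems aft[of j] by simp
  qed (simp add: mem_after_def)
  have mid': "mid_mem a xa xb' j = mid_mem a xa xb j" if "j < p" for j
    using same[of j] that by (simp add: mid_mem_def)
  have first: "first_out a xa xb' p = first_out a xa xb p"
    using same by (simp add: first_out_def)
  have second: "second_out a xa xb' p = second_out a xa' xb' p"
    using mid mid' len by (simp add: second_out_def)
  \<comment> \<open>The transcript lists memories from the end of the first pass on; without any
    pass the memory is \<open>init_mem a\<close> in both runs.\<close>
  have final: "mem_after a p (xa @ xb') = mem_after a p (xa' @ xb')"
    using same[of p] aft[of "p - 1"] by (cases p) (simp_all add: mem_after_def)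
  \<comment> \<open>If the first half's output is recorded, the mixed run outputs exactly what the
    run on \<open>xa' @ xb'\<close> does. Otherwise that output alone is already too large in both
    runs with \<open>xa\<close>.\<close>
  have "small_subset m k (output_positions a p (xa @ xb')) = small_subset m k (output_positions a p (xa @ xb))"
  proof (cases "small_subset m k (first_out a xa xb p)")
    case True
    then have "first_out a xa xb p = first_out a xa' xb' p"
      using eq by (simp add: transcript_def split: if_splits)
    then have "output_positions a p (xa @ xb') = output_positions a p (xa' @ xb')"
      by (simp add: output_positions_split first second final)
    then show ?thesis
      using eq by (simp add: transcript_def)
  next
    case False
    then show ?thesis
      using small_subset_mono[of m k _ "first_out a xa xb p"]
      by (metis Un_upper1 first le_supI1 output_positions_split)
  qed
  then show ?thesis
    using same mid' first by (simp add: transcript_def)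
qed

section \<open>Counting transcripts\<close>

definition transcripts :: "nat \<Rightarrow> nat \<Rightarrow> nat \<Rightarrow> nat
    \<Rightarrow> (bool list list \<times> bool list list \<times> nat set option \<times> bool) set" where
  "transcripts s p m k =
     {us. set us \<subseteq> {w. length w = s} \<and> length us = p} \<times> {us. set us \<subseteq> {w. length w = s} \<and> length us = p}
       \<times> insert None (Some ` {P. small_subset m k P}) \<times> UNIV"

lemma transcript_in_transcripts:
  assumes "uses_memory a s"
  shows "transcript a p m k xa xb \<in> transcripts s p m k"
  using assms by (auto simp: transcript_def transcripts_def mid_mem_def
      intro!: length_run_pass length_mem_after)

lemma finite_small_subsets: "finite {P. small_subset m k P}"
  by (rule finite_subset[of _ "Pow {..<m}"]) (auto simp: small_subset_def)

text \<open>Every such set is listed by a word of length exactly \<open>k\<close> over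
  \<open>{..m}\<close>, where \<open>m\<close>, not a stream position, serves as padding.\<close>

lemma card_small_subsets_le: "card {P. small_subset m k P} \<le> (m + 1) ^ k"
proof -
  have "{P. small_subset m k P} \<subseteq> (\<lambda>ps. set ps - {m}) ` {ps. set ps \<subseteq> {..m} \<and> length ps = k}"
  proof
    fix P assume "P \<in> {P. small_subset m k P}"
    then have P: "P \<subseteq> {..<m}" "card P \<le> k"
      by (auto simp: small_subset_def)
    obtain ps where ps: "set ps = P" "distinct ps"
      using P(1) finite_distinct_list finite_subset by (metis finite_lessThan)
    define qs where "qs = ps @ replicate (k - card P) m"
    have "length qs = k" "set qs \<subseteq> {..m}" "set qs - {m} = P"
      using P ps distinct_card[OF ps(2)] by (auto simp: qs_def)
    then show "P \<in> (\<lambda>ps. set ps - {m}) ` {ps. set ps \<subseteq> {..m} \<and> length ps = k}"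
      by blast
  qed
  then have "card {P. small_subset m k P} \<le> card {ps. set ps \<subseteq> {..m} \<and> length ps = k}"
    by (intro surj_card_le finite_lists_length_eq) auto
  then show ?thesis
    by (simp add: card_lists_length_eq)
qed

lemma finite_bool_lists: "finite {w :: bool list. length w = s}"
  and card_bool_lists: "card {w :: bool list. length w = s} = 2 ^ s"
  using finite_lists_length_eq[of "UNIV :: bool set" s] card_lists_length_eq[of "UNIV :: bool set" s]
  by (auto simp: card_UNIV_bool)

lemma finite_transcripts: "finite (transcripts s p m k)"
  unfolding transcripts_def
  by (intro finite_cartesian_product finite_lists_length_eq finite_bool_lists) (auto simp: finite_small_subsets)

lemma card_transcripts_le: "card (transcripts s p m k) \<le> 2 ^ (2 * p * s) * ((m + 1) ^ k * 4)"
proof -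
  have "card (insert None (Some ` {P. small_subset m k P})) \<le> (m + 1) ^ k + 1"
    using card_small_subsets_le[of m k] finite_small_subsets[of m k]
    by (subst card_insert_disjoint) (auto simp: card_image)
  also have "\<dots> \<le> (m + 1) ^ k * 2"
    by simp
  finally have "card (insert None (Some ` {P. small_subset m k P})) * 2 \<le> (m + 1) ^ k * 4"
    by simp
  moreover have "card (transcripts s p m k)
      = 2 ^ (2 * p * s) * (card (insert None (Some ` {P. small_subset m k P})) * 2)"
    unfolding transcripts_def
    by (simp add: card_cartesian_product card_lists_length_eq finite_bool_lists card_bool_lists card_UNIV_bool
        mult_ac flip: power_mult power_add mult_2)
  ultimately show ?thesis
    by simp
qed

text \<open>The crude \<open>ln (m + 1) \<le> m\<close> suffices: with \<open>k\<close> at most 3 in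
  the applications, this term is of lower order than \<open>m * sqrt n\<close>.\<close>

lemma ln_card_transcripts_le:
  "ln (card (transcripts s p m k)) \<le> 2 * real p * real s + real k * real m + 2"
proof -
  have "card (transcripts s p m k) > 0"
    using finite_transcripts by (auto simp: card_gt_0_iff transcripts_def intro!: exI[of _ "replicate p (replicate s True)"])
  then have "ln (card (transcripts s p m k)) \<le> ln (real (2 ^ (2 * p * s) * ((m + 1) ^ k * 4)))"
    using card_transcripts_le by (subst ln_le_cancel_iff) (auto simp del: of_nat_mult of_nat_power)
  also have "\<dots> = real (2 * p * s) * ln 2 + (real k * ln (real m + 1) + 2 * ln 2)"
  proof -
    have "ln (4 :: real) = 2 * ln 2"
      using ln_realpow[of 2 2] by simp
    then show ?thesis
      by (simp add: ln_mult_pos ln_realpow add.commute)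
  qed
  also have "\<dots> \<le> real (2 * p * s) * 1 + (real k * real m + 2 * 1)"
    using ln_le_minus_one[of 2] ln_le_minus_one[of "real m + 1"]
    by (intro add_mono mult_left_mono) auto
  finally show ?thesis by simp
qed

text \<open>The averaging half of Yao's principle: a lower bound on the weighted error count of
  every deterministic algorithm survives the expectation over \<open>A\<close>. The weight
  \<open>w\<close> balances two families of inputs of different sizes.\<close>

lemma pmf_weighted_average_ge:
  fixes A :: "'a pmf"
  assumes "finite P" "finite Q" "w \<ge> 0"
    and "\<And>x. x \<in> P \<Longrightarrow> measure_pmf.prob A (E x) \<le> \<epsilon>" "\<And>x. x \<in> Q \<Longrightarrow> measure_pmf.prob A (F x) \<le> \<epsilon>"
    and c: "\<And>a. a \<in> set_pmf A \<Longrightarrow> c \<le> w * (\<Sum>x\<in>P. indicat_real (E x) a) + (\<Sum>x\<in>Q. indicat_real (F x) a)"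
  shows "c \<le> \<epsilon> * (w * card P + card Q)"
proof -
  let ?f = "\<lambda>a. w * (\<Sum>x\<in>P. indicat_real (E x) a) + (\<Sum>x\<in>Q. indicat_real (F x) a)"
  have ind: "integrable (measure_pmf A) (indicat_real S)" for S
    by (simp add: integrable_indicator_iff measure_pmf.emeasure_eq_measure)
  have int: "integrable (measure_pmf A) ?f"
    by (intro Bochner_Integration.integrable_add integrable_mult_right Bochner_Integration.integrable_sum ind)
  have "c \<le> measure_pmf.expectation A ?f"
    by (rule measure_pmf.integral_ge_const[OF int]) (use c in \<open>auto simp: AE_measure_pmf_iff\<close>)
  also have "\<dots> = w * (\<Sum>x\<in>P. measure_pmf.prob A (E x)) + (\<Sum>x\<in>Q. measure_pmf.prob A (F x))"
    by (simp add: Bochner_Integration.integral_add Bochner_Integration.integral_sum integrable_mult_right ind)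
  also have "\<dots> \<le> w * (\<Sum>x\<in>P. \<epsilon>) + (\<Sum>x\<in>Q. \<epsilon>)"
    by (intro add_mono mult_left_mono sum_mono assms)
  finally show ?thesis
    by (simp add: algebra_simps)
qed

text \<open>The stream has no repetitions, so counting output positions counts the sets of a minimum
  cover.\<close>

lemma correct_output_small_iff:
  assumes "correct_output a p n xs" "set_cover_stream n m xs"
  shows "small_subset m k (output_positions a p xs)
    \<longleftrightarrow> (\<exists>\<C>. set_cover {..<n} (set xs) \<C> \<and> card \<C> \<le> k)"
proof -
  let ?O = "output_positions a p xs"
  have O: "?O \<subseteq> {..<m}" and min: "minimum_set_cover {..<n} (set xs) ((!) xs ` ?O)"
    and xs: "distinct xs" "length xs = m"
    using assms by (auto simp: correct_output_def set_cover_stream_def)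
  have "inj_on ((!) xs) ?O"
    using O xs by (intro inj_on_nth) auto
  then have "card ((!) xs ` ?O) = card ?O"
    by (rule card_image)
  then show ?thesis
    using O min unfolding small_subset_def minimum_set_cover_def by (metis order_trans)
qed

lemma streaming_disjointness_bound:
  fixes I :: "'i set" and first second :: "'i set \<Rightarrow> nat set list"
  assumes I: "finite I"
    and stream: "\<And>x y. x \<subseteq> I \<Longrightarrow> y \<subseteq> I \<Longrightarrow> set_cover_stream n m (first x @ second y)"
    and len: "\<And>x. x \<subseteq> I \<Longrightarrow> length (first x) = l"
    and decide: "\<And>x y. x \<subseteq> I \<Longrightarrow> y \<subseteq> I \<Longrightarrow>
      (\<exists>\<C>. set_cover {..<n} (set (first x @ second y)) \<C> \<and> card \<C> \<le> k) \<longleftrightarrow> (b \<longleftrightarrow> x \<inter> y = {})"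
    and A: "randomized_memory A s" "solves_set_cover A p n m \<epsilon>" and \<epsilon>: "\<epsilon> < 1 / 2"
  shows "(1 - 2 * \<epsilon>)\<^sup>2 * card I \<le> 108 * (2 * real p * real s + real k * real m + 2)"
proof -
  define \<gamma> where "\<gamma> = 1 - 2 * \<epsilon>"
  have \<gamma>: "\<gamma> > 0"
    using \<epsilon> by (simp add: \<gamma>_def)
  \<comment> \<open>This choice makes \<open>3 * N / r\<close> equal to
    \<open>\<gamma> * N / 2\<close>, half of the advantage; the rest must come from the transcript
    length.\<close>
  define r where "r = 6 / \<gamma>"
  have r: "r > 0"
    using \<gamma> by (simp add: r_def)
  define N where "N = real (card I)"
  define K where "K = ln (card (transcripts s p m k))"
  define wrong where "wrong x y = {a. \<not> correct_output a p n (first x @ second y)}" for x y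
  \<comment> \<open>A deterministic algorithm with few transcripts errs on disjoint or on planted
    pairs. Each disjoint pair gets weight \<open>N\<close>, matching the \<open>N\<close> choices of
    the planted element.\<close>
  have lower: "4 ^ card I * (N - (9 * r * K + 3 * N / r))
      \<le> N * (\<Sum>(D, Z)\<in>Pow I \<times> Pow I. indicat_real (wrong (Z \<inter> D) (Z - D)) a)
        + (\<Sum>(j, D, Z)\<in>I \<times> Pow I \<times> Pow I. indicat_real (wrong (insert j (Z \<inter> D)) (insert j (Z - D))) a)"
    if a: "a \<in> set_pmf A" for a
  proof -
    have mem: "uses_memory a s"
      using A(1) a by (simp add: randomized_memory_def)
    define T where "T x y = transcript a p m k (first x) (second y)" for x y
    \<comment> \<open>The last transcript bit is the threshold test; \<open>acc\<close> is 1 when it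
      declares the inputs disjoint.\<close>
    define acc :: "bool list list \<times> bool list list \<times> nat set option \<times> bool \<Rightarrow> real"
      where "acc \<tau> = of_bool (snd (snd (snd \<tau>)) = b)" for \<tau>
    let ?e0 = "\<lambda>D Z. indicat_real (wrong (Z \<inter> D) (Z - D)) a"
    let ?e1 = "\<lambda>j D Z. indicat_real (wrong (insert j (Z \<inter> D)) (insert j (Z - D))) a"
    have bit: "snd (snd (snd (T x y))) \<longleftrightarrow> (b \<longleftrightarrow> x \<inter> y = {})"
      if "x \<subseteq> I" "y \<subseteq> I" "a \<notin> wrong x y" for x y
      using correct_output_small_iff[OF _ stream[OF that(1,2)], of a p k] decide[OF that(1,2)] that(3)
      by (simp add: T_def transcript_def wrong_def)
    have "\<bar>N * (\<Sum>D\<in>Pow I. \<Sum>Z\<in>Pow I. acc (T (Z \<inter> D) (Z - D)))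
        - (\<Sum>j\<in>I. \<Sum>D\<in>Pow I. \<Sum>Z\<in>Pow I. acc (T (insert j (Z \<inter> D)) (insert j (Z - D))))\<bar>
        \<le> 4 ^ card I * (9 * r * K + 3 * N / r)"
      unfolding N_def K_def
    proof (rule planted_average_diff_le[OF I finite_transcripts])
      show "T x y \<in> transcripts s p m k" for x y
        unfolding T_def by (rule transcript_in_transcripts[OF mem])
      show "T x y' = T x y" if "x \<subseteq> I" "x' \<subseteq> I" "T x y = T x' y'" for x y x' y'
        using transcript_rectangle[of a p m k "first x" "second y" "first x'" "second y'"] that len
        by (simp add: T_def)
    qed (auto simp: acc_def r)
    moreover have "N * (\<Sum>D\<in>Pow I. \<Sum>Z\<in>Pow I. 1 - ?e0 D Z)
        \<le> N * (\<Sum>D\<in>Pow I. \<Sum>Z\<in>Pow I. acc (T (Z \<inter> D) (Z - D)))"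
    proof (intro mult_left_mono sum_mono)
      fix D Z assume "D \<in> Pow I" "Z \<in> Pow I"
      then have "Z \<inter> D \<subseteq> I" "Z - D \<subseteq> I" "Z \<inter> D \<inter> (Z - D) = {}"
        by auto
      then show "1 - ?e0 D Z \<le> acc (T (Z \<inter> D) (Z - D))"
        using bit[of "Z \<inter> D" "Z - D"] by (auto simp: acc_def indicator_def)
    qed (simp add: N_def)
    moreover have "(\<Sum>j\<in>I. \<Sum>D\<in>Pow I. \<Sum>Z\<in>Pow I. acc (T (insert j (Z \<inter> D)) (insert j (Z - D))))
        \<le> (\<Sum>j\<in>I. \<Sum>D\<in>Pow I. \<Sum>Z\<in>Pow I. ?e1 j D Z)"
    proof (intro sum_mono)
      fix j D Z assume "j \<in> I" "D \<in> Pow I" "Z \<in> Pow I"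
      then have "insert j (Z \<inter> D) \<subseteq> I" "insert j (Z - D) \<subseteq> I" "insert j (Z \<inter> D) \<inter> insert j (Z - D) \<noteq> {}"
        by auto
      then show "acc (T (insert j (Z \<inter> D)) (insert j (Z - D))) \<le> ?e1 j D Z"
        using bit[of "insert j (Z \<inter> D)" "insert j (Z - D)"] by (auto simp: acc_def indicator_def)
    qed
    moreover have "(\<Sum>D\<in>Pow I. \<Sum>Z\<in>Pow I. 1 - ?e0 D Z) = 4 ^ card I - (\<Sum>D\<in>Pow I. \<Sum>Z\<in>Pow I. ?e0 D Z)"
    proof -
      have "(4 :: real) ^ card I = 2 ^ card I * 2 ^ card I"
        by (simp flip: power_mult_distrib)
      then show ?thesis
        using I by (simp add: sum_subtractf card_Pow)
    qed
    ultimately have "N * (4 ^ card I - (\<Sum>D\<in>Pow I. \<Sum>Z\<in>Pow I. ?e0 D Z))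
        - (\<Sum>j\<in>I. \<Sum>D\<in>Pow I. \<Sum>Z\<in>Pow I. ?e1 j D Z) \<le> 4 ^ card I * (9 * r * K + 3 * N / r)"
      by simp
    then show ?thesis
      by (simp add: sum.cartesian_product[symmetric] algebra_simps)
  qed
  have err: "measure_pmf.prob A (wrong x y) \<le> \<epsilon>" if "x \<subseteq> I" "y \<subseteq> I" for x y
    using A(2) stream[OF that] by (simp add: solves_set_cover_def wrong_def)
  have "4 ^ card I * (N - (9 * r * K + 3 * N / r)) \<le> \<epsilon> * (N * card (Pow I \<times> Pow I) + card (I \<times> Pow I \<times> Pow I))"
  proof (rule pmf_weighted_average_ge)
    show "4 ^ card I * (N - (9 * r * K + 3 * N / r))
        \<le> N * (\<Sum>q\<in>Pow I \<times> Pow I. indicat_real (case q of (D, Z) \<Rightarrow> wrong (Z \<inter> D) (Z - D)) a)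
          + (\<Sum>q\<in>I \<times> Pow I \<times> Pow I. indicat_real (case q of (j, D, Z) \<Rightarrow> wrong (insert j (Z \<inter> D)) (insert j (Z - D))) a)"
      if "a \<in> set_pmf A" for a
      using lower[OF that] by (simp add: case_prod_unfold)
  qed (use I in \<open>auto simp: N_def intro!: err\<close>)
  \<comment> \<open>Both families have total weight \<open>N * 4 ^ card I\<close>.\<close>
  also have "\<dots> = 4 ^ card I * (2 * \<epsilon> * N)"
  proof -
    have "(4 :: real) ^ card I = 2 ^ card I * 2 ^ card I"
      by (simp flip: power_mult_distrib)
    then show ?thesis
      using I by (simp add: card_cartesian_product card_Pow N_def)
  qed
  finally have "N - (9 * r * K + 3 * N / r) \<le> 2 * \<epsilon> * N"
    by simp
  then have "\<gamma> * N \<le> 9 * r * K + 3 * N / r"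
    by (simp add: \<gamma>_def algebra_simps)
  also have "\<dots> = 54 * K / \<gamma> + \<gamma> * N / 2"
    using \<gamma> by (simp add: r_def)
  finally have "\<gamma> * N \<le> 108 * K / \<gamma>"
    by simp
  then have "\<gamma>\<^sup>2 * N \<le> 108 * K"
    using \<gamma> by (simp add: field_simps power2_eq_square)
  also have "\<dots> \<le> 108 * (2 * real p * real s + real k * real m + 2)"
    unfolding K_def by (intro mult_left_mono ln_card_transcripts_le) auto
  finally show ?thesis
    unfolding \<gamma>_def N_def .
qed

section \<open>Disjointness as set cover\<close>

text \<open>Padding sets confined to a block \<open>G\<close> away from the encoding fill the family
  up to exactly \<open>m\<close> members.\<close>

lemma obtain_padding:
  assumes "finite G" "l \<le> 2 ^ card G"
  obtains ps where "distinct ps" "set ps \<subseteq> Pow G" "length ps = l"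
proof -
  obtain P where P: "P \<subseteq> Pow G" "card P = l"
    using obtain_subset_with_card_n[of l "Pow G"] assms by (metis card_Pow)
  then have "finite P"
    using assms(1) finite_subset by auto
  then obtain ps where "set ps = P" "distinct ps"
    using finite_distinct_list by blast
  with P that show ?thesis
    using distinct_card by metis
qed

text \<open>The markers \<open>N\<close> and \<open>N + 1\<close> lie only in \<open>S x\<close> and
  \<open>T y\<close>, so a cover by two sets must be this pair. The set \<open>Z\<close> keeps the
  input coverable when \<open>x\<close> and \<open>y\<close> intersect, and its element 0 tells it
  from the padding.\<close>

lemma disjointness_to_two_sets:
  assumes N: "1 \<le> N" "N + 2 \<le> n" and m: "3 \<le> m" "m - 3 \<le> 2 ^ (n - (N + 2))"
    and A: "randomized_memory A s" "solves_set_cover A p n m \<epsilon>" "\<epsilon> < 1 / 2"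
  shows "(1 - 2 * \<epsilon>)\<^sup>2 * N \<le> 108 * (2 * real p * real s + 2 * real m + 2)"
proof -
  obtain ps where ps: "distinct ps" "set ps \<subseteq> Pow {N + 2..<n}" "length ps = m - 3"
    using obtain_padding[of "{N + 2..<n}" "m - 3"] m by auto
  define S where "S x = ({..<N} - x) \<union> {N} \<union> {N + 2..<n}" for x
  define T where "T y = ({..<N} - y) \<union> {N + 1}" for y
  define Z where "Z = {..<N}"
  define first where "first x = S x # Z # ps" for x
  define second where "second y = [T y]" for y
  have mem: "N \<in> S x" "N + 1 \<notin> S x" "N \<notin> T y" "N + 1 \<in> T y" "N \<notin> Z" "N + 1 \<notin> Z" "0 \<in> Z" for x y
    using N by (auto simp: S_def T_def Z_def)
  have pad: "0 \<notin> P \<and> N \<notin> P \<and> N + 1 \<notin> P" if "P \<in> set ps" for P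
    using ps(2) that by fastforce
  have "(1 - 2 * \<epsilon>)\<^sup>2 * card {..<N} \<le> 108 * (2 * real p * real s + real 2 * real m + 2)"
  proof (rule streaming_disjointness_bound[where first = first and second = second and b = True, OF _ _ _ _ A])
    fix x y :: "nat set"
    assume "x \<subseteq> {..<N}" "y \<subseteq> {..<N}"
    have "distinct (first x @ second y)"
      using ps(1) pad mem unfolding first_def second_def by auto metis+
    moreover have "set (first x @ second y) \<subseteq> Pow {..<n}"
      using ps(2) N by (fastforce simp: first_def second_def S_def T_def Z_def)
    moreover have "{..<n} \<subseteq> S x \<union> T y \<union> Z"
      using N by (auto simp: S_def T_def Z_def)
    ultimately show "set_cover_stream n m (first x @ second y)"
      using ps(3) m unfolding set_cover_stream_def first_def second_def by auto
    show "(\<exists>\<C>. set_cover {..<n} (set (first x @ second y)) \<C> \<and> card \<C> \<le> 2) \<longleftrightarrow> (True \<longleftrightarrow> x \<inter> y = {})"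
    proof
      assume "\<exists>\<C>. set_cover {..<n} (set (first x @ second y)) \<C> \<and> card \<C> \<le> 2"
      then obtain \<C> where C: "\<C> \<subseteq> set (first x @ second y)" "\<Union>\<C> = {..<n}" "card \<C> \<le> 2"
        by (auto simp: set_cover_def)
      have fin: "finite \<C>"
        using C(1) by (rule finite_subset) simp
      have "N \<in> \<Union>\<C>" "N + 1 \<in> \<Union>\<C>"
        using C(2) N by auto
      then have ST: "S x \<in> \<C>" "T y \<in> \<C>"
        using C(1) mem pad unfolding first_def second_def by auto
      have "{S x, T y} = \<C>"
        using ST C(3) mem(1)[of x] mem(3)[of y] by (intro card_seteq fin) (auto simp: card_insert_if)
      then have "S x \<union> T y = {..<n}"
        using C(2) by auto
      then show "True \<longleftrightarrow> x \<inter> y = {}"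
        using \<open>x \<subseteq> {..<N}\<close> N unfolding S_def T_def by fastforce
    next
      assume "True \<longleftrightarrow> x \<inter> y = {}"
      then have "S x \<union> T y = {..<n}"
        using N unfolding S_def T_def by auto
      then have "set_cover {..<n} (set (first x @ second y)) {S x, T y}"
        by (auto simp: set_cover_def first_def second_def)
      then show "\<exists>\<C>. set_cover {..<n} (set (first x @ second y)) \<C> \<and> card \<C> \<le> 2"
        by (intro exI[of _ "{S x, T y}"]) (auto simp: card_insert_if)
    qed
  qed (auto simp: first_def)
  then show ?thesis
    by simp
qed

text \<open>
  A cover by three sets consists of one \<open>S x i\<close>, one \<open>T y i'\<close> and one \<open>R j\<close>, because of the
  markers \<open>3 * q\<close>, \<open>3 * q + 1\<close> and \<open>3 * q + 2\<close>. The block \<open>{2 * q..<3 * q}\<close> forces \<open>i = i'\<close>,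
  and the copies \<open>j\<close> and \<open>q + j\<close> of \<open>j\<close> left open by \<open>R j\<close> force \<open>(i, j) \<in> x \<inter> y\<close>.
\<close>

lemma disjointness_to_three_sets:
  assumes q: "1 \<le> q" "3 * q + 3 \<le> n" and m: "3 * q + 1 \<le> m" "m - (3 * q + 1) \<le> 2 ^ (n - (3 * q + 3))"
    and A: "randomized_memory A s" "solves_set_cover A p n m \<epsilon>" "\<epsilon> < 1 / 2"
  shows "(1 - 2 * \<epsilon>)\<^sup>2 * (real q)\<^sup>2 \<le> 108 * (2 * real p * real s + 3 * real m + 2)"
proof -
  obtain ps where ps: "distinct ps" "set ps \<subseteq> Pow {3 * q + 3..<n}" "length ps = m - (3 * q + 1)"
    using obtain_padding[of "{3 * q + 3..<n}" "m - (3 * q + 1)"] m by auto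
  define I where "I = {..<q} \<times> {..<q}"
  \<comment> \<open>Rows of \<open>x\<close> use the first copy of the columns and rows of
    \<open>y\<close> the second. The hole of \<open>S x i\<close> at \<open>2 * q + i\<close> is
    what \<open>T y i\<close> fills.\<close>
  define S where "S x i = {j. (i, j) \<in> x} \<union> ({2 * q..<3 * q} - {2 * q + i}) \<union> {3 * q} \<union> {3 * q + 3..<n}"
    for x :: "(nat \<times> nat) set" and i
  define T where "T y i = (\<lambda>j. q + j) ` {j. (i, j) \<in> y} \<union> {2 * q + i} \<union> {3 * q + 1}"
    for y :: "(nat \<times> nat) set" and i
  define R where "R j = ({..<2 * q} - {j, q + j}) \<union> {3 * q + 2}" for j
  \<comment> \<open>With one set of each other kind, \<open>Z\<close> covers the ground set, so the
    input is legal for all \<open>x\<close> and \<open>y\<close>; its element \<open>2 * q\<close>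
    tells it from the padding.\<close>
  define Z where "Z = {..<3 * q}"
  define first where "first x = map (S x) [0..<q] @ map R [0..<q] @ Z # ps" for x
  define second where "second y = map (T y) [0..<q]" for y
  have mem: "3 * q \<in> S x i" "3 * q + 1 \<notin> S x i" "3 * q + 2 \<notin> S x i"
    "3 * q \<notin> T y i" "3 * q + 1 \<in> T y i" "3 * q + 2 \<notin> T y i"
    "3 * q \<notin> R i" "3 * q + 1 \<notin> R i" "3 * q + 2 \<in> R i"
    if "x \<subseteq> I" "y \<subseteq> I" "i < q" for x y i
    using q that by (auto simp: S_def T_def R_def I_def)
  have memZ: "3 * q \<notin> Z" "3 * q + 1 \<notin> Z" "3 * q + 2 \<notin> Z" "2 * q \<in> Z"
    using q by (auto simp: Z_def)
  have pad: "2 * q \<notin> P \<and> 3 * q \<notin> P \<and> 3 * q + 1 \<notin> P \<and> 3 * q + 2 \<notin> P" if "P \<in> set ps" for P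
    using ps(2) that by fastforce
  have injS: "inj_on (S x) {0..<q}" if "x \<subseteq> I" for x
  proof (rule inj_onI, rule ccontr)
    fix i i' assume "i \<in> {0..<q}" "i' \<in> {0..<q}" "S x i = S x i'" "i \<noteq> i'"
    moreover have "2 * q + i' \<in> S x i"
      using \<open>i' \<in> {0..<q}\<close> \<open>i \<noteq> i'\<close> by (auto simp: S_def)
    moreover have "2 * q + i' \<notin> S x i'"
      using that \<open>i' \<in> {0..<q}\<close> by (auto simp: S_def I_def)
    ultimately show False by simp
  qed
  have injT: "inj_on (T y) {0..<q}" if "y \<subseteq> I" for y
  proof (rule inj_onI)
    fix i i' assume "i \<in> {0..<q}" "i' \<in> {0..<q}" "T y i = T y i'"
    moreover have "2 * q + i \<in> T y i"
      by (auto simp: T_def)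
    moreover have "2 * q + i \<notin> T y i'" if "i \<noteq> i'"
      using that \<open>y \<subseteq> I\<close> \<open>i \<in> {0..<q}\<close> by (auto simp: T_def I_def)
    ultimately show "i = i'"
      by auto
  qed
  have injR: "inj_on R {0..<q}"
  proof (rule inj_onI, rule ccontr)
    fix j j' assume "j \<in> {0..<q}" "j' \<in> {0..<q}" "R j = R j'" "j \<noteq> j'"
    moreover have "j \<in> R j'" "j \<notin> R j"
      using \<open>j \<in> {0..<q}\<close> \<open>j' \<in> {0..<q}\<close> \<open>j \<noteq> j'\<close> by (auto simp: R_def)
    ultimately show False by simp
  qed
  have "(1 - 2 * \<epsilon>)\<^sup>2 * card I \<le> 108 * (2 * real p * real s + real 3 * real m + 2)"
  proof (rule streaming_disjointness_bound[where first = first and second = second and b = False, OF _ _ _ _ A])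
    show "finite I"
      by (simp add: I_def)
    fix x y
    assume x: "x \<subseteq> I" and y: "y \<subseteq> I"
    note mem = mem[OF x y]
    have set: "set (first x @ second y) = S x ` {..<q} \<union> R ` {..<q} \<union> {Z} \<union> set ps \<union> T y ` {..<q}"
      by (auto simp: first_def second_def)
    have "distinct (first x @ second y)"
    proof -
      have "S x i \<noteq> R j" "S x i \<noteq> T y j" "R i \<noteq> T y j" if "i < q" "j < q" for i j
        using mem[OF that(1)] mem[OF that(2)] by metis+
      moreover have "Z \<noteq> S x i" "Z \<noteq> R i" "Z \<noteq> T y i" "S x i \<notin> set ps" "R i \<notin> set ps" "T y i \<notin> set ps"
        if "i < q" for i
        using mem[OF that] memZ pad by metis+
      then have "Z \<notin> S x ` {..<q}" "Z \<notin> R ` {..<q}" "Z \<notin> T y ` {..<q}"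
        "S x ` {..<q} \<inter> set ps = {}" "R ` {..<q} \<inter> set ps = {}" "T y ` {..<q} \<inter> set ps = {}"
        by blast+
      moreover have "Z \<notin> set ps"
        using memZ pad by auto
      ultimately show ?thesis
        using ps(1) injS[OF x] injT[OF y] injR unfolding first_def second_def
        by (auto simp: distinct_map atLeast0LessThan)
    qed
    moreover have "set (first x @ second y) \<subseteq> Pow {..<n}"
    proof -
      have "set ps \<subseteq> Pow {..<n}"
        using ps(2) by (rule order_trans) auto
      then show ?thesis
        unfolding set using q x y by (auto simp: S_def R_def Z_def T_def I_def)
    qed
    moreover have "{..<n} \<subseteq> \<Union>(set (first x @ second y))"
    proof -
      have "{..<n} \<subseteq> Z \<union> S x 0 \<union> T y 0 \<union> R 0"
        using q by (auto simp: S_def R_def Z_def T_def)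
      also have "\<dots> \<subseteq> \<Union>(set (first x @ second y))"
        unfolding set using q by (intro Un_least Union_upper) auto
      finally show ?thesis .
    qed
    moreover have "length (first x @ second y) = m"
      using ps(3) m by (simp add: first_def second_def)
    ultimately show "set_cover_stream n m (first x @ second y)"
      unfolding set_cover_stream_def by auto
    show "(\<exists>\<C>. set_cover {..<n} (set (first x @ second y)) \<C> \<and> card \<C> \<le> 3) \<longleftrightarrow> (False \<longleftrightarrow> x \<inter> y = {})"
    proof
      assume "\<exists>\<C>. set_cover {..<n} (set (first x @ second y)) \<C> \<and> card \<C> \<le> 3"
      then obtain \<C> where C: "\<C> \<subseteq> set (first x @ second y)" "\<Union>\<C> = {..<n}" "card \<C> \<le> 3"
        by (auto simp: set_cover_def)
      have fin: "finite \<C>"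
        using C(1) by (rule finite_subset) simp
      have "3 * q \<in> \<Union>\<C>" "3 * q + 1 \<in> \<Union>\<C>" "3 * q + 2 \<in> \<Union>\<C>"
        using C(2) q by auto
      then obtain P1 P2 P3 where P: "P1 \<in> \<C>" "3 * q \<in> P1" "P2 \<in> \<C>" "3 * q + 1 \<in> P2" "P3 \<in> \<C>" "3 * q + 2 \<in> P3"
        by blast
      have "P \<in> S x ` {..<q} \<or> P \<in> R ` {..<q} \<or> P \<in> T y ` {..<q} \<or> P = Z \<or> P \<in> set ps" if "P \<in> \<C>" for P
        using that C(1) unfolding set by blast
      then have "P1 \<in> S x ` {..<q}" "P2 \<in> T y ` {..<q}" "P3 \<in> R ` {..<q}"
        using P pad mem memZ by (metis imageE lessThan_iff)+
      then obtain i i' j where ij: "i < q" "i' < q" "j < q" "S x i \<in> \<C>" "T y i' \<in> \<C>" "R j \<in> \<C>"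
        using P by blast
      have "S x i \<noteq> T y i'" "S x i \<noteq> R j" "T y i' \<noteq> R j"
        using mem[OF ij(1)] mem[OF ij(2)] mem[OF ij(3)] by metis+
      then have "{S x i, T y i', R j} = \<C>"
        using ij C(3) by (intro card_seteq fin) (auto simp: card_insert_if)
      then have cover: "{..<n} = S x i \<union> T y i' \<union> R j"
        using C(2) by auto
      have "2 * q + i \<in> S x i \<union> T y i' \<union> R j" "j \<in> S x i \<union> T y i' \<union> R j" "q + j \<in> S x i \<union> T y i' \<union> R j"
        using ij(1,3) q unfolding cover[symmetric] by auto
      \<comment> \<open>The two copies separate the players: each table row has to fill the gap of
        \<open>R j\<close> in its own copy.\<close>
      moreover have "2 * q + i \<notin> S x i \<union> R j" "j \<notin> T y i' \<union> R j" "q + j \<notin> S x i \<union> R j"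
        using ij x unfolding S_def R_def T_def I_def by auto
      ultimately have "2 * q + i \<in> T y i'" "j \<in> S x i" "q + j \<in> T y i'"
        by auto
      then have "i = i'" "(i, j) \<in> x" "(i', j) \<in> y"
        using ij y unfolding S_def T_def I_def by auto
      then show "False \<longleftrightarrow> x \<inter> y = {}"
        by auto
    next
      assume "False \<longleftrightarrow> x \<inter> y = {}"
      then obtain i j where ij: "(i, j) \<in> x" "(i, j) \<in> y"
        by auto
      then have "i < q" "j < q"
        using x by (auto simp: I_def)
      have sub: "{S x i, T y i, R j} \<subseteq> set (first x @ second y)"
        unfolding set using \<open>i < q\<close> \<open>j < q\<close> by auto
      have "{..<n} \<subseteq> S x i \<union> T y i \<union> R j"
      proof
        fix u assume "u \<in> {..<n}"
        then consider "u = j" | "u = q + j" | "u < 2 * q" "u \<noteq> j" "u \<noteq> q + j" | "u = 2 * q + i"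
          | "2 * q \<le> u" "u < 3 * q" "u \<noteq> 2 * q + i" | "u = 3 * q" | "u = 3 * q + 1" | "u = 3 * q + 2"
          | "3 * q + 3 \<le> u" "u < n"
          by fastforce
        then show "u \<in> S x i \<union> T y i \<union> R j"
          using ij by cases (auto simp: S_def T_def R_def)
      qed
      moreover have "S x i \<union> T y i \<union> R j \<subseteq> {..<n}"
        using x y q \<open>i < q\<close> by (auto simp: S_def T_def R_def I_def)
      ultimately have "set_cover {..<n} (set (first x @ second y)) {S x i, T y i, R j}"
        using sub unfolding set_cover_def by auto
      moreover have "card {S x i, T y i, R j} \<le> 3"
        by (simp add: card_insert_if)
      ultimately show "\<exists>\<C>. set_cover {..<n} (set (first x @ second y)) \<C> \<and> card \<C> \<le> 3"
        by blast
    qed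
  qed (auto simp: first_def)
  then show ?thesis
    by (simp add: I_def power2_eq_square)
qed

section \<open>The lower bound\<close>

text \<open>For \<open>m\<^sup>2 \<le> n\<close> the two-set encoding has about
  \<open>n / 2 \<ge> m * sqrt n / 2\<close> points. Otherwise \<open>sqrt n \<le> m\<close>, and the
  \<open>q \<times> q\<close> table has order \<open>m\<^sup>2\<close> points for fixed
  \<open>C\<close>.\<close>

lemma memory_passes_lower_bound:
  fixes \<epsilon> C :: real
  assumes \<epsilon>: "\<epsilon> < 1 / 2"
  shows "\<exists>c > 0. \<exists>n\<^sub>0. \<forall>n \<ge> n\<^sub>0. \<forall>m \<ge> 8. real m \<le> C * real n \<longrightarrow>
    (\<forall>p A s. randomized_memory A s \<longrightarrow> solves_set_cover A p n m \<epsilon> \<longrightarrow>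
       c * real m * sqrt n \<le> real p * real s)"
proof -
  define \<gamma> where "\<gamma> = (1 - 2 * \<epsilon>)\<^sup>2"
  have \<gamma>: "\<gamma> > 0"
    using \<epsilon> by (simp add: \<gamma>_def)
  \<comment> \<open>Both bounds on \<open>D\<close> are used to get
    \<open>m / D \<le> min m n\<close>.\<close>
  define D where "D = max 1 C"
  have D: "D \<ge> 1" "C \<le> D"
    by (auto simp: D_def)
  \<comment> \<open>The square of the factor in \<open>q \<ge> m / (16 * D)\<close>.\<close>
  define b where "b = 1 / (256 * D\<^sup>2)"
  have b: "b > 0" "b \<le> 1 / 3"
  proof -
    have "1 \<le> D\<^sup>2"
      using D by (simp add: one_le_power)
    then show "b > 0" "b \<le> 1 / 3"
      unfolding b_def by (auto simp: divide_simps)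
  qed
  have "\<forall>\<^sub>F n :: nat in sequentially. D * real n \<le> 2 powr (real n / 2 - 3)"
    by real_asymp
  moreover have "\<forall>\<^sub>F n :: nat in sequentially. 1080 / (\<gamma> * b) \<le> sqrt (real n)"
    by real_asymp
  moreover have "\<forall>\<^sub>F n :: nat in sequentially. 24 \<le> n"
    by (rule eventually_ge_at_top)
  ultimately have "\<forall>\<^sub>F n :: nat in sequentially. D * real n \<le> 2 powr (real n / 2 - 3)
      \<and> 1080 / (\<gamma> * b) \<le> sqrt (real n) \<and> 24 \<le> n"
    by eventually_elim simp
  then obtain n0 where n0: "\<And>n. n \<ge> n0 \<Longrightarrow> D * real n \<le> 2 powr (real n / 2 - 3)"
    "\<And>n. n \<ge> n0 \<Longrightarrow> 1080 / (\<gamma> * b) \<le> sqrt (real n)" "\<And>n. n \<ge> n0 \<Longrightarrow> 24 \<le> n"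
    unfolding eventually_sequentially by blast
  \<comment> \<open>Large \<open>n\<close> lets half of the main term absorb
    \<open>108 * (3 * m + 2)\<close>; the other half against \<open>216 * p * s\<close> gives
    432.\<close>
  have "\<gamma> * b / 432 * real m * sqrt n \<le> real p * real s"
    if n: "n \<ge> n0" and m: "m \<ge> 8" and mC: "real m \<le> C * real n"
      and A: "randomized_memory A s" "solves_set_cover A p n m \<epsilon>" for n m p A s
  proof -
    have n24: "24 \<le> n"
      using n0(3)[OF n] .
    have mD: "real m \<le> D * real n"
      using mC D(2) mult_right_mono[of C D "real n"] by linarith
    \<comment> \<open>In both encodings about half of the ground set stays free, and its power set
      exceeds the linear bound on \<open>m\<close>.\<close>
    have pads: "m \<le> 2 ^ l" if "n div 2 \<le> l + 2" for l
    proof -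
      have "real n / 2 - 3 \<le> real l"
        using that by linarith
      then have "2 powr (real n / 2 - 3) \<le> 2 powr real l"
        by simp
      then have "real m \<le> 2 ^ l"
        using mD n0(1)[OF n] by (simp only: powr_realpow zero_less_numeral)
      then show ?thesis
        by simp
    qed
    have "\<gamma> * (b * real m * sqrt n) \<le> 108 * (2 * real p * real s + 3 * real m + 2)"
    proof (cases "m\<^sup>2 \<le> n")
      case True
      define N where "N = n div 2"
      have "m \<le> 2 ^ (n - (N + 2))"
        by (rule pads) (use n24 in \<open>unfold N_def, linarith\<close>)
      then have pad: "m - 3 \<le> 2 ^ (n - (N + 2))"
        by linarith
      have "\<gamma> * real N \<le> 108 * (2 * real p * real s + 2 * real m + 2)"
        unfolding \<gamma>_def
        by (rule disjointness_to_two_sets[OF _ _ _ _ A \<epsilon>]) (use n24 m pad in \<open>auto simp: N_def\<close>)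
      also have "\<dots> \<le> 108 * (2 * real p * real s + 3 * real m + 2)"
        by simp
      finally have "\<gamma> * real N \<le> 108 * (2 * real p * real s + 3 * real m + 2)" .
      moreover have "b * real m * sqrt n \<le> real N"
      proof -
        have "real m \<le> sqrt n"
          using True by (intro real_le_rsqrt) (simp flip: of_nat_power)
        then have "real m * sqrt n \<le> sqrt n * sqrt n"
          by (intro mult_right_mono) auto
        then have "b * (real m * sqrt n) \<le> 1 / 3 * real n"
          using b by (intro mult_mono) auto
        also have "\<dots> \<le> real N"
          using n24 unfolding N_def by linarith
        finally show ?thesis by (simp add: mult_ac)
      qed
      then have "\<gamma> * (b * real m * sqrt n) \<le> \<gamma> * real N"
        using \<gamma> by (intro mult_left_mono) auto
      ultimately show ?thesis
        by (rule order_trans[rotated])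
    next
      case False
      define q where "q = min m n div 8"
      have q: "1 \<le> q" "3 * q + 1 \<le> m" "8 * q \<le> n"
        using n24 m unfolding q_def by linarith+
      have "m \<le> 2 ^ (n - (3 * q + 3))"
        by (rule pads) (use n24 q in linarith)
      then have pad: "m - (3 * q + 1) \<le> 2 ^ (n - (3 * q + 3))"
        by linarith
      have "\<gamma> * (real q)\<^sup>2 \<le> 108 * (2 * real p * real s + 3 * real m + 2)"
        unfolding \<gamma>_def
        by (rule disjointness_to_three_sets[OF _ _ _ _ A \<epsilon>]) (use n24 q pad in auto)
      moreover have "b * real m * sqrt n \<le> (real q)\<^sup>2"
      proof -
        have "real m \<le> D * real m"
          using D mult_right_mono[of 1 D "real m"] by simp
        then have "real m / D \<le> real (min m n)"
          using mD D by (simp add: min_def pos_divide_le_eq mult.commute)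
        also have "\<dots> \<le> 16 * real q"
        proof -
          \<comment> \<open>From 8 on, rounding down to a multiple of 8 loses at most a factor of
            two.\<close>
          have "k \<le> 16 * (k div 8)" if "8 \<le> k" for k :: nat
            using that by presburger
          from this[of "min m n"] have "min m n \<le> 16 * q"
            using n24 m unfolding q_def by simp
          then show ?thesis
            by linarith
        qed
        finally have "real m / (16 * D) \<le> real q"
          using D by (simp add: field_simps)
        then have "(real m / (16 * D))\<^sup>2 \<le> (real q)\<^sup>2"
          using D by (intro power_mono) auto
        moreover have "(real m / (16 * D))\<^sup>2 = b * real m * real m"
          by (simp add: b_def power_divide power_mult_distrib power2_eq_square)
        moreover have "sqrt n \<le> real m"
          using False by (intro real_le_lsqrt) (auto simp flip: of_nat_power)
        then have "b * real m * sqrt n \<le> b * real m * real m"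
          using b by (intro mult_left_mono) auto
        ultimately show ?thesis
          by linarith
      qed
      then have "\<gamma> * (b * real m * sqrt n) \<le> \<gamma> * (real q)\<^sup>2"
        using \<gamma> by (intro mult_left_mono) auto
      ultimately show ?thesis
        by (rule order_trans[rotated])
    qed
    moreover have "108 * (3 * real m + 2) \<le> \<gamma> * (b * real m * sqrt n) / 2"
    proof -
      have "1080 \<le> \<gamma> * b * sqrt n"
        using n0(2)[OF n] \<gamma> b by (simp add: pos_divide_le_eq mult_ac)
      then have "real m * 1080 \<le> real m * (\<gamma> * b * sqrt n)"
        by (intro mult_left_mono) auto
      also have "\<dots> = \<gamma> * (b * real m * sqrt n)"
        by (simp add: mult_ac)
      finally have "real m * 1080 / 2 \<le> \<gamma> * (b * real m * sqrt n) / 2"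
        by simp
      moreover have "108 * (3 * real m + 2) \<le> real m * 1080 / 2"
        using m by simp
      ultimately show ?thesis
        by (rule order_trans[rotated])
    qed
    ultimately show ?thesis
      by (simp add: algebra_simps)
  qed
  then show ?thesis
    using \<gamma> b by (intro exI[of _ "\<gamma> * b / 432"] conjI exI[of _ n0]) auto
qed

theorem theorem5p4:
  fixes \<epsilon> C :: real
  assumes "0 < \<epsilon>" and "\<epsilon> < 1 / 2" and "0 < C"
  shows "\<exists>c > 0. \<exists>K n\<^sub>0 m\<^sub>0 :: nat. \<forall>n \<ge> n\<^sub>0. \<forall>m \<ge> m\<^sub>0. real m \<le> C * real n \<longrightarrow>
    (\<forall>(\<delta> :: real) (passes :: nat) (A :: stream_algorithm pmf) (s :: nat).
       log 2 (log 2 (real n)) / log 2 (real n) \<le> \<delta> \<longrightarrow>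
       real passes \<le> 1 / (2 * \<delta>) - 1 \<longrightarrow>
       randomized_memory A s \<longrightarrow>
       solves_set_cover A passes n m \<epsilon> \<longrightarrow>
       real s \<ge> c * (real m * real n powr \<delta>) / (log 2 (real n * real m)) ^ K)"
proof -
  obtain c n1 where c: "c > 0" and bound:
    "\<And>n m p A s. n \<ge> n1 \<Longrightarrow> m \<ge> 8 \<Longrightarrow> real m \<le> C * real n \<Longrightarrow> randomized_memory A s \<Longrightarrow>
      solves_set_cover A p n m \<epsilon> \<Longrightarrow> c * real m * sqrt n \<le> real p * real s"
    using memory_passes_lower_bound[OF assms(2), of C] by blast
  \<comment> \<open>The exponent \<open>K = 1\<close> is enough: the only logarithmic loss is the
    number of passes, bounded by \<open>1 / \<delta>\<close>.\<close>
  have "c * (real m * real n powr \<delta>) / (log 2 (real n * real m)) ^ 1 \<le> real s"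
    if n: "n \<ge> max n1 4" and m: "m \<ge> 8" "real m \<le> C * real n"
      and \<delta>: "log 2 (log 2 (real n)) / log 2 (real n) \<le> \<delta>" and p: "real p \<le> 1 / (2 * \<delta>) - 1"
      and A: "randomized_memory A s" "solves_set_cover A p n m \<epsilon>" for n m \<delta> p A s
  proof -
    define L where "L = log 2 (real n)"
    \<comment> \<open>From \<open>n \<ge> 4\<close>, so that \<open>log 2 L \<ge> 1\<close> and the
      hypothesis on \<open>\<delta>\<close> yields \<open>\<delta> \<ge> 1 / L > 0\<close>.\<close>
    have L: "L \<ge> 2"
      unfolding L_def using n by (subst le_log_iff) auto
    then have LL: "1 \<le> log 2 L"
      by (subst le_log_iff) auto
    have "1 / L \<le> \<delta>"
      using \<delta> LL L divide_right_mono[of 1 "log 2 L" L] unfolding L_def by linarith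
    moreover from this have \<delta>_pos: "\<delta> > 0"
      using L less_le_trans[of 0 "1 / L" \<delta>] by simp
    ultimately have inv: "1 / \<delta> \<le> L"
      using L by (simp add: field_simps)
    have "\<delta> \<le> 1 / 2"
    proof -
      have "1 \<le> 1 / (2 * \<delta>)"
        using p by linarith
      then show ?thesis
        using \<delta>_pos by (simp add: field_simps)
    qed
    then have "real n powr \<delta> \<le> real n powr (1 / 2)"
      using n by (intro powr_mono) auto
    then have pow: "real n powr \<delta> \<le> sqrt n"
      using n by (simp add: powr_half_sqrt)
    have Lm: "L \<le> log 2 (real n * real m)"
      unfolding L_def using n m by (subst log_le_cancel_iff) auto
    have "1 / (2 * \<delta>) \<le> 1 / \<delta>"
      using \<delta>_pos by (simp add: field_simps)
    then have "real p \<le> 1 / \<delta>"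
      using p by linarith
    then have pL: "real p \<le> log 2 (real n * real m)"
      using inv Lm by linarith
    have "c * (real m * real n powr \<delta>) \<le> c * (real m * sqrt n)"
      using c pow by (intro mult_left_mono) auto
    also have "\<dots> \<le> real p * real s"
      using bound[of n m A s p] n m A by (simp add: mult_ac)
    also have "\<dots> \<le> log 2 (real n * real m) * real s"
      using pL by (intro mult_right_mono) auto
    finally show ?thesis
      using L Lm by (simp add: pos_divide_le_eq mult.commute)
  qed
  then show ?thesis
    using c by (intro exI[of _ c] conjI exI[of _ "1 :: nat"] exI[of _ "max n1 4"] exI[of _ "8 :: nat"]) auto
qed

end
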